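(* Let $G=(V,E)$ be an infinite, countable, connected, locally finite, quasi-transitive graph. Consider either nearest-neighbour Bernoulli bond (edge) percolation or nearest-neighbour Bernoulli site percolation on $G$. Then for every vertex $x\in V$ $$\lim_{p\uparrow p_T}\mathbb{E}_p(|C_x|)=\infty .$$ In particular, $\mathbb{E}_{p_T}(|C_x|)=\infty$ for every $x\in V$.
   Context: A graph $G$ is quasi-transitive if its automorphism group $\mathrm{Aut}(G)$ acts on $V$ with finitely many orbits. Bond percolation with parameter $p\in[0,1]$: each edge is independently open with probability $p$ and closed with probability $1-p$; $G(\omega)$ is the subgraph with vertex set $V$ whose edges are the open edges. Site percolation with parameter $p$: each vertex is independently open with probability $p$ and closed with probability $1-p$; $G(\omega)$ is the subgraph of $G$ induced by the open vertices. In both cases $\mathbb{P}_p$ is the corresponding product measure and $\mathbb{E}_p$ its expectation. The cluster $C_x(\omega)$ is the connected component of $G(\omega)$ containing $x$ (in the site model it is empty if $x$ is closed), and $|C_x|$ is its number of vertices (possibly infinite). $p_T:=\sup\{p\in[0,1]:\ \mathbb{E}_p(|C_x|)<\infty\}$, which does not depend on the choice of $x$. *)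

theory Defs
  imports "HOL-Probability.Probability"
begin

definition simple_graph :: "'a set \<Rightarrow> 'a set set \<Rightarrow> bool" where
  "simple_graph V E \<longleftrightarrow> (\<forall>e\<in>E. e \<subseteq> V \<and> card e = 2)"

definition adj_rel :: "'a set set \<Rightarrow> ('a \<times> 'a) set" where
  "adj_rel E = {(u, v). {u, v} \<in> E}"

text \<open>The component of a vertex outside \<open>V\<close> is empty; this gives the convention that the site
  percolation cluster of a closed vertex is empty.\<close>

definition graph_component :: "'a set \<Rightarrow> 'a set set \<Rightarrow> 'a \<Rightarrow> 'a set" where
  "graph_component V E x = {y. x \<in> V \<and> y \<in> V \<and> (x, y) \<in> (adj_rel E)\<^sup>*}"

definition connected_graph :: "'a set \<Rightarrow> 'a set set \<Rightarrow> bool" where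
  "connected_graph V E \<longleftrightarrow> (\<forall>x\<in>V. \<forall>y\<in>V. (x, y) \<in> (adj_rel E)\<^sup>*)"

definition locally_finite_graph :: "'a set \<Rightarrow> 'a set set \<Rightarrow> bool" where
  "locally_finite_graph V E \<longleftrightarrow> (\<forall>x\<in>V. finite {e \<in> E. x \<in> e})"

text \<open>Automorphisms are total functions whose values outside \<open>V\<close> are arbitrary; orbits of vertices
  do not depend on those values.\<close>

definition graph_auts :: "'a set \<Rightarrow> 'a set set \<Rightarrow> ('a \<Rightarrow> 'a) set" where
  "graph_auts V E =
     {f. bij_betw f V V \<and> (\<forall>x\<in>V. \<forall>y\<in>V. {f x, f y} \<in> E \<longleftrightarrow> {x, y} \<in> E)}"

definition aut_orbit :: "'a set \<Rightarrow> 'a set set \<Rightarrow> 'a \<Rightarrow> 'a set" where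
  "aut_orbit V E x = (\<lambda>f. f x) ` graph_auts V E"

definition quasi_transitive_graph :: "'a set \<Rightarrow> 'a set set \<Rightarrow> bool" where
  "quasi_transitive_graph V E \<longleftrightarrow> finite (aut_orbit V E ` V)"

text \<open>Configurations on \<open>I\<close> (the edge set or the vertex set); \<open>True\<close> means open.\<close>

definition bernoulli_product :: "'i set \<Rightarrow> real \<Rightarrow> ('i \<Rightarrow> bool) measure" where
  "bernoulli_product I p = PiM I (\<lambda>_. measure_pmf (bernoulli_pmf p))"

definition bond_cluster :: "'a set \<Rightarrow> 'a set set \<Rightarrow> ('a set \<Rightarrow> bool) \<Rightarrow> 'a \<Rightarrow> 'a set" where
  "bond_cluster V E \<omega> x = graph_component V {e \<in> E. \<omega> e} x"

definition site_cluster :: "'a set \<Rightarrow> 'a set set \<Rightarrow> ('a \<Rightarrow> bool) \<Rightarrow> 'a \<Rightarrow> 'a set" where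
  "site_cluster V E \<omega> x = graph_component {v \<in> V. \<omega> v} {e \<in> E. \<forall>v\<in>e. \<omega> v} x"

text \<open>Cluster sizes are measured by counting measure, so that an infinite cluster has
  size \<open>\<infinity>\<close>.\<close>

definition bond_mean_size :: "'a set \<Rightarrow> 'a set set \<Rightarrow> real \<Rightarrow> 'a \<Rightarrow> ennreal" where
  "bond_mean_size V E p x =
     (\<integral>\<^sup>+\<omega>. emeasure (count_space UNIV) (bond_cluster V E \<omega> x) \<partial>bernoulli_product E p)"

definition site_mean_size :: "'a set \<Rightarrow> 'a set set \<Rightarrow> real \<Rightarrow> 'a \<Rightarrow> ennreal" where
  "site_mean_size V E p x =
     (\<integral>\<^sup>+\<omega>. emeasure (count_space UNIV) (site_cluster V E \<omega> x) \<partial>bernoulli_product V p)"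

definition bond_pT :: "'a set \<Rightarrow> 'a set set \<Rightarrow> 'a \<Rightarrow> real" where
  "bond_pT V E x = Sup {p \<in> {0..1}. bond_mean_size V E p x < \<infinity>}"

definition site_pT :: "'a set \<Rightarrow> 'a set set \<Rightarrow> 'a \<Rightarrow> real" where
  "site_pT V E x = Sup {p \<in> {0..1}. site_mean_size V E p x < \<infinity>}"

end

theory Submission imports Defs begin

text \<open>Call the set of parameters with finite mean cluster size the subcritical set. The mean cluster
  size is the supremum, over finite windows, of the mean size of the cluster inside the window,
  and each of the latter is a polynomial in the parameter. Hence the mean cluster size is lower
  semicontinuous, and it diverges whenever the parameter tends to a value at which it is infinite
  (\<open>susceptibility_lower_semicontinuous\<close>). What remains is that it is infinite at the supremum of the
  subcritical set, which holds because no parameter below \<open>1\<close> is a maximum of that set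
  (\<open>susceptibility_finite_open\<close>), while at parameter \<open>1\<close> the cluster is the whole infinite graph.

  Subcriticality is stable under a small increase of the parameter because it has a finite-size
  criterion. For a finite set \<open>S\<close> around \<open>x\<close>, let \<open>escape\<close> be the sum, over the edges \<open>(u, v)\<close> that
  leave \<open>S\<close>, of the probability that \<open>x\<close> is joined to \<open>u\<close> inside \<open>S\<close>. A path from \<open>x\<close> to a far away
  point has a last visit to the cluster \<open>C\<close> of \<open>x\<close> inside \<open>S\<close>; from there it crosses one such edge, and
  it then avoids every site that has to be inspected in order to know \<open>C\<close>. The rest of the path is
  thus independent of \<open>C\<close>, and the mean cluster size is at most \<open>|S|\<close> plus \<open>escape\<close> times the largest
  mean cluster size (\<open>mean_size_le_escape\<close>). If \<open>escape\<close> is at most \<open>1/2\<close> for sets \<open>S\<close> of bounded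
  size around every vertex, then the mean size is bounded (\<open>mean_size_bounded_by_escape\<close>).
  Conversely, if the mean cluster size of \<open>x\<close> is finite, then the expected number of cluster points
  at distance \<open>n\<close> from \<open>x\<close> is summable in \<open>n\<close>, and a large ball has \<open>escape\<close> below \<open>1/2\<close>
  (\<open>escape_ball_less\<close>). The quantity \<open>escape\<close> is continuous in the parameter and invariant under
  automorphisms, so that quasi-transitivity reduces the criterion at a slightly larger parameter to
  finitely many vertices.

  Both models are treated at once as site percolation in which only the sites of a set \<open>I\<close> are
  random and the others are always open. For bond percolation the graph is the incidence graph, with
  the vertices and the edges of the original graph as its sites and with \<open>I\<close> the set of edges; its
  clusters contain the bond clusters and are larger by at most a constant factor.\<close>

section \<open>Expectations over finitely many independent sites\<close>

text \<open>The expectation of \<open>f\<close> of the random set of open sites, when each site \<open>i\<close> of the finite set \<open>J\<close>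
  is open with probability \<open>q i\<close> independently. As an explicit finite sum it is visibly continuous
  in \<open>q\<close>, and no measurability is involved until the passage to infinite graphs.\<close>

definition bexp :: "'w set \<Rightarrow> ('w \<Rightarrow> real) \<Rightarrow> ('w set \<Rightarrow> real) \<Rightarrow> real" where
  "bexp J q f = (\<Sum>A\<in>Pow J. (\<Prod>i\<in>A. q i) * (\<Prod>i\<in>J - A. 1 - q i) * f A)"

lemma bexp_empty [simp]: "bexp {} q f = f {}"
  by (simp add: bexp_def)

text \<open>Conditioning on the state of one site. This is the recursion behind the inductive proofs below.\<close>

lemma bexp_insert:
  assumes "finite J" "j \<notin> J"
  shows "bexp (insert j J) q f = q j * bexp J q (\<lambda>A. f (insert j A)) + (1 - q j) * bexp J q f"
proof -
  have inj: "inj_on (insert j) (Pow J)"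
    using assms(2) by (auto simp: inj_on_def)
  have disj: "Pow J \<inter> insert j ` Pow J = {}"
    using assms(2) by auto
  have in_part: "(\<Prod>i\<in>insert j A. q i) * (\<Prod>i\<in>insert j J - insert j A. 1 - q i) * f (insert j A)
      = q j * ((\<Prod>i\<in>A. q i) * (\<Prod>i\<in>J - A. 1 - q i) * f (insert j A))" if "A \<in> Pow J" for A
  proof -
    have "finite A" "j \<notin> A" "insert j J - insert j A = J - A"
      using that assms finite_subset by auto
    then show ?thesis by simp
  qed
  have out_part: "(\<Prod>i\<in>A. q i) * (\<Prod>i\<in>insert j J - A. 1 - q i) * f A
      = (1 - q j) * ((\<Prod>i\<in>A. q i) * (\<Prod>i\<in>J - A. 1 - q i) * f A)" if "A \<in> Pow J" for A
  proof -
    have "insert j J - A = insert j (J - A)" "j \<notin> J - A" "finite (J - A)"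
      using that assms by auto
    then show ?thesis by simp
  qed
  let ?F = "\<lambda>A. (\<Prod>i\<in>A. q i) * (\<Prod>i\<in>insert j J - A. 1 - q i) * f A"
  have "bexp (insert j J) q f = (\<Sum>A\<in>Pow J. ?F A) + (\<Sum>A\<in>insert j ` Pow J. ?F A)"
    unfolding bexp_def Pow_insert using assms(1) disj by (intro sum.union_disjoint) auto
  also have "(\<Sum>A\<in>insert j ` Pow J. ?F A) = (\<Sum>A\<in>Pow J. ?F (insert j A))"
    using sum.reindex[OF inj, of ?F] by (simp only: o_def)
  also have "\<dots> = q j * bexp J q (\<lambda>A. f (insert j A))"
    unfolding bexp_def sum_distrib_left by (rule sum.cong[OF refl in_part])
  also have "(\<Sum>A\<in>Pow J. ?F A) = (1 - q j) * bexp J q f"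
    unfolding bexp_def sum_distrib_left by (rule sum.cong[OF refl out_part])
  finally show ?thesis by simp
qed

lemma bexp_cong: "(\<And>A. A \<subseteq> J \<Longrightarrow> f A = g A) \<Longrightarrow> bexp J q f = bexp J q g"
  by (auto simp: bexp_def intro!: sum.cong)

lemma bexp_const: "finite J \<Longrightarrow> bexp J q (\<lambda>_. c) = c"
  by (induction J rule: finite_induct) (auto simp: bexp_insert algebra_simps)

lemma bexp_add: "bexp J q (\<lambda>A. f A + g A) = bexp J q f + bexp J q g"
  by (simp add: bexp_def algebra_simps sum.distrib)

lemma bexp_sum: "bexp J q (\<lambda>A. \<Sum>k\<in>K. f k A) = (\<Sum>k\<in>K. bexp J q (f k))"
  unfolding bexp_def sum_distrib_left by (rule sum.swap)

lemma bexp_mono: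
  assumes "\<And>i. i \<in> J \<Longrightarrow> 0 \<le> q i \<and> q i \<le> 1" "\<And>A. A \<subseteq> J \<Longrightarrow> f A \<le> g A"
  shows "bexp J q f \<le> bexp J q g"
  unfolding bexp_def
  by (intro sum_mono mult_left_mono mult_nonneg_nonneg prod_nonneg) (use assms in auto)

lemma bexp_marginal:
  assumes "finite J" "K \<subseteq> J"
  shows "bexp J q (\<lambda>A. f (A \<inter> K)) = bexp K q f"
proof -
  have "bexp (K \<union> L) q (\<lambda>A. f (A \<inter> K)) = bexp K q f" if "finite L" "L \<inter> K = {}" for L
    using that
  proof (induction L rule: finite_induct)
    case empty
    show ?case by (auto intro!: bexp_cong arg_cong[where f=f])
  next
    case (insert l L)
    have fin: "finite (K \<union> L)" "l \<notin> K \<union> L"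
      using insert assms finite_subset by auto
    then have "insert l A \<inter> K = A \<inter> K" for A
      by auto
    then show ?case
      using insert bexp_insert[OF fin, of q "\<lambda>A. f (A \<inter> K)"] by (simp add: algebra_simps)
  qed
  from this[of "J - K"] show ?thesis
    using assms by (simp add: Un_absorb1 Int_commute)
qed

text \<open>Functions of the states inside and outside of \<open>D\<close> are independent. The induction on \<open>J\<close> has to
  range over all \<open>f\<close> and \<open>g\<close>, since opening the new site changes one of the two functions.\<close>

lemma bexp_indep:
  assumes "finite J" "\<And>A. f A = f (A \<inter> D)" "\<And>A. g A = g (A - D)"
  shows "bexp J q (\<lambda>A. f A * g A) = bexp J q f * bexp J q g"
  using assms
proof (induction J arbitrary: f g rule: finite_induct)
  case empty
  show ?case by simp
next
  case (insert j J)
  note ins = bexp_insert[OF insert.hyps]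
  have IH: "bexp J q (\<lambda>A. f A * g A) = bexp J q f * bexp J q g"
    by (rule insert.IH[of f g]) (rule insert.prems)+
  show ?case
  proof (cases "j \<in> D")
    case True
    have g: "g (insert j A) = g A" for A
      using insert.prems(2)[of A] insert.prems(2)[of "insert j A"] True by (simp add: insert_Diff_if)
    have f: "f (insert j A) = f (insert j (A \<inter> D))" for A
    proof -
      have "insert j A \<inter> D = insert j (A \<inter> D) \<inter> D" by auto
      then show ?thesis using insert.prems(1) by metis
    qed
    have "bexp J q (\<lambda>A. f (insert j A) * g A) = bexp J q (\<lambda>A. f (insert j A)) * bexp J q g"
      using f insert.prems(2) by (intro insert.IH)
    with IH show ?thesis
      by (simp add: ins g algebra_simps)
  next
    case False
    have f: "f (insert j A) = f A" for A
      using insert.prems(1)[of A] insert.prems(1)[of "insert j A"] False by (simp add: Int_insert_left)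
    have g: "g (insert j A) = g (insert j (A - D))" for A
    proof -
      have "insert j A - D = insert j (A - D) - D" by auto
      then show ?thesis using insert.prems(2) by metis
    qed
    have "bexp J q (\<lambda>A. f A * g (insert j A)) = bexp J q f * bexp J q (\<lambda>A. g (insert j A))"
      using g insert.prems(1) by (intro insert.IH)
    with IH show ?thesis
      by (simp add: ins f algebra_simps)
  qed
qed

lemma bexp_reindex:
  assumes "inj_on h J" "finite J"
  shows "bexp (h ` J) q f = bexp J (\<lambda>i. q (h i)) (\<lambda>A. f (h ` A))"
  using assms(2,1)
proof (induction J arbitrary: f rule: finite_induct)
  case (insert j J)
  then have "h j \<notin> h ` J" "inj_on h J" by auto
  then show ?case
    using insert.hyps insert.IH by (simp add: bexp_insert)
qed simp

text \<open>Sites of weight \<open>1\<close> allow models that mix random sites with sites that are always open.\<close>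

lemma bexp_certain:
  assumes "finite K" "finite L" "K \<inter> L = {}" "\<And>i. i \<in> L \<Longrightarrow> q i = 1"
  shows "bexp (K \<union> L) q f = bexp K q (\<lambda>A. f (A \<union> L))"
  using assms(2,3,4)
proof (induction L arbitrary: f rule: finite_induct)
  case (insert l L)
  have "finite (K \<union> L)" "l \<notin> K \<union> L" using insert assms(1) by auto
  then show ?case
    using insert by (simp add: bexp_insert)
qed simp

lemma bexp_impossible:
  assumes "finite K" "finite L" "K \<inter> L = {}" "\<And>i. i \<in> L \<Longrightarrow> q i = 0"
  shows "bexp (K \<union> L) q f = bexp K q f"
  using assms(2,3,4)
proof (induction L arbitrary: f rule: finite_induct)
  case (insert l L)
  have "finite (K \<union> L)" "l \<notin> K \<union> L" using insert assms(1) by auto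
  then show ?case
    using insert by (simp add: bexp_insert)
qed simp

lemma isCont_bexp:
  assumes "\<And>i. isCont (\<lambda>p. q p i) p0"
  shows "isCont (\<lambda>p. bexp J (q p) f) p0"
  unfolding bexp_def by (intro continuous_intros assms)

lemma bexp_cmult: "bexp J q (\<lambda>A. c * f A) = c * bexp J q f"
  by (simp add: bexp_def sum_distrib_left algebra_simps)

lemma bexp_mono_set:
  assumes "finite J" "K \<subseteq> J" "\<And>i. i \<in> J \<Longrightarrow> 0 \<le> q i \<and> q i \<le> 1" "\<And>A B. A \<subseteq> B \<Longrightarrow> B \<subseteq> J \<Longrightarrow> f A \<le> f B"
  shows "bexp K q f \<le> bexp J q f"
  unfolding bexp_marginal[OF assms(1,2), of q f, symmetric]
  by (rule bexp_mono) (use assms in auto)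

lemma bexp_nonneg:
  assumes "finite J" "\<And>i. i \<in> J \<Longrightarrow> 0 \<le> q i \<and> q i \<le> 1" "\<And>A. A \<subseteq> J \<Longrightarrow> 0 \<le> f A"
  shows "0 \<le> bexp J q f"
  using bexp_mono[of J q "\<lambda>_. 0" f] bexp_const[of J q 0] assms by auto

section \<open>Clusters\<close>

text \<open>As for components, the cluster of a closed site is empty.\<close>

definition cluster :: "('w \<times> 'w) set \<Rightarrow> 'w set \<Rightarrow> 'w \<Rightarrow> 'w set" where
  "cluster N A x = {y. x \<in> A \<and> (x, y) \<in> (N \<inter> A \<times> A)\<^sup>*}"

lemma cluster_self: "x \<in> A \<Longrightarrow> x \<in> cluster N A x"
  by (simp add: cluster_def)

lemma cluster_step: "y \<in> cluster N A x \<Longrightarrow> (y, z) \<in> N \<Longrightarrow> y \<in> A \<Longrightarrow> z \<in> A \<Longrightarrow> z \<in> cluster N A x"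
  by (auto simp: cluster_def intro: rtrancl.rtrancl_into_rtrancl)

lemma cluster_induct [consumes 1, case_names self step]:
  assumes "y \<in> cluster N A x"
    and "x \<in> A \<Longrightarrow> P x"
    and "\<And>y z. y \<in> cluster N A x \<Longrightarrow> y \<in> A \<Longrightarrow> z \<in> A \<Longrightarrow> (y, z) \<in> N \<Longrightarrow> P y \<Longrightarrow> P z"
  shows "P y"
proof -
  from assms(1) have "x \<in> A" "(x, y) \<in> (N \<inter> A \<times> A)\<^sup>*" by (auto simp: cluster_def)
  from this(2) show ?thesis
    by (induction rule: rtrancl_induct) (use assms(2,3) \<open>x \<in> A\<close> in \<open>auto simp: cluster_def\<close>)
qed

lemma cluster_subset: "cluster N A x \<subseteq> A"
proof
  fix y assume "y \<in> cluster N A x"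
  then show "y \<in> A" by (induction rule: cluster_induct)
qed

lemma cluster_outside: "x \<notin> A \<Longrightarrow> cluster N A x = {}"
  by (auto simp: cluster_def)

lemma cluster_mono: "A \<subseteq> B \<Longrightarrow> cluster N A x \<subseteq> cluster N B x"
  using rtrancl_mono[of "N \<inter> A \<times> A" "N \<inter> B \<times> B"] by (auto simp: cluster_def)

text \<open>Opening a site \<open>x\<close> makes its cluster absorb the cluster of each neighbour.\<close>

lemma cluster_neighbour:
  assumes "(x, z) \<in> N"
  shows "cluster N A z \<subseteq> cluster N (insert x A) x"
proof
  fix y assume "y \<in> cluster N A z"
  then show "y \<in> cluster N (insert x A) x"
  proof (induction rule: cluster_induct)
    case self
    then show ?case by (intro cluster_step[OF cluster_self assms]) auto
  next
    case (step y w)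
    then show ?case by (intro cluster_step[OF step(5,4)]) auto
  qed
qed

lemma cluster_image_subset:
  assumes "\<And>u v. u \<in> A \<Longrightarrow> v \<in> A \<Longrightarrow> (u, v) \<in> N \<Longrightarrow> (h u, h v) \<in> N'"
  shows "h ` cluster N A x \<subseteq> cluster N' (h ` A) (h x)"
proof safe
  fix y assume "y \<in> cluster N A x"
  then show "h y \<in> cluster N' (h ` A) (h x)"
  proof (induction rule: cluster_induct)
    case self
    then show ?case by (intro cluster_self) auto
  next
    case (step y w)
    then show ?case by (intro cluster_step[OF step(5) assms]) auto
  qed
qed

lemma cluster_image:
  assumes "inj_on h B" "A \<subseteq> B" "x \<in> B"
    and "\<And>u v. u \<in> B \<Longrightarrow> v \<in> B \<Longrightarrow> (h u, h v) \<in> N' \<longleftrightarrow> (u, v) \<in> N"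
  shows "cluster N' (h ` A) (h x) = h ` cluster N A x"
proof (rule subset_antisym)
  let ?g = "inv_into B h"
  have g: "?g (h u) = u" if "u \<in> B" for u
    using that assms(1) by simp
  have gA: "?g ` (h ` A) = A"
    using g assms(2) by (auto simp: image_image subset_eq)
  have "?g ` cluster N' (h ` A) (h x) \<subseteq> cluster N (?g ` (h ` A)) (?g (h x))"
    by (rule cluster_image_subset) (use assms g in \<open>auto simp: subset_eq\<close>)
  then have "?g ` cluster N' (h ` A) (h x) \<subseteq> cluster N A x"
    using gA g[OF assms(3)] by simp
  then have "h ` ?g ` cluster N' (h ` A) (h x) \<subseteq> h ` cluster N A x"
    by blast
  moreover have "h ` ?g ` cluster N' (h ` A) (h x) = cluster N' (h ` A) (h x)"
  proof -
    have "h (?g y) = y" if "y \<in> cluster N' (h ` A) (h x)" for y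
      using that cluster_subset[of N' "h ` A" "h x"] g assms(2) by (auto simp: subset_eq)
    then show ?thesis by (simp add: image_image)
  qed
  ultimately show "cluster N' (h ` A) (h x) \<subseteq> h ` cluster N A x" by simp
  show "h ` cluster N A x \<subseteq> cluster N' (h ` A) (h x)"
    by (rule cluster_image_subset) (use assms in \<open>auto simp: subset_eq\<close>)
qed

text \<open>The sites whose states decide whether \<open>C\<close>, if nonempty, is a cluster inside \<open>S\<close>: those of \<open>C\<close>,
  which have to be open, and their remaining neighbours in \<open>S\<close>, which have to be closed.\<close>

definition explored :: "('w \<times> 'w) set \<Rightarrow> 'w set \<Rightarrow> 'w set \<Rightarrow> 'w set" where
  "explored N S C = C \<union> (N `` C \<inter> S)"

text \<open>In both configurations \<open>C\<close> is open, so the cluster loses no point of \<open>C\<close>, and the neighbours of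
  \<open>C\<close> in \<open>S\<close> are closed, so it does not grow beyond \<open>C\<close>.\<close>

lemma cluster_eq_local:
  assumes "C = cluster N (A \<inter> S) x" "x \<in> C" "A \<inter> explored N S C = B \<inter> explored N S C"
  shows "C = cluster N (B \<inter> S) x"
proof (intro subset_antisym subsetI)
  have CA: "C \<subseteq> A \<inter> S" unfolding assms(1) by (rule cluster_subset)
  then have CB: "C \<subseteq> B \<inter> S" using assms(3) by (auto simp: explored_def)
  fix y assume "y \<in> C"
  then have "y \<in> cluster N (A \<inter> S) x" using assms(1) by simp
  then show "y \<in> cluster N (B \<inter> S) x"
  proof (induction rule: cluster_induct)
    case self
    then show ?case using assms(2) CB by (intro cluster_self) auto
  next
    case (step y z)
    have "z \<in> C" using cluster_step[OF step(1,4,2,3)] assms(1) by simp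
    moreover have "y \<in> C" using step(1) assms(1) by simp
    ultimately show ?case using step(5,4) CB by (meson cluster_step subsetD)
  qed
next
  fix y assume "y \<in> cluster N (B \<inter> S) x"
  then show "y \<in> C"
  proof (induction rule: cluster_induct)
    case self
    show ?case by (rule assms(2))
  next
    case (step y z)
    have "z \<in> explored N S C" using step by (auto simp: explored_def)
    then have "z \<in> A \<inter> S" using step assms(3) by auto
    moreover have "y \<in> A \<inter> S" using step(5) cluster_subset unfolding assms(1) by fast
    ultimately show ?case using step(4,5) cluster_step unfolding assms(1) by fast
  qed
qed

text \<open>Consider the last site \<open>u\<close> of \<open>C\<close> on an open path to \<open>y\<close>. The next site \<open>v\<close> is outside of \<open>S\<close>, since
  it would otherwise belong to \<open>C\<close>. The path after \<open>u\<close> meets no explored site: an open explored site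
  belongs to \<open>C\<close>. In the proof the path is extended by one step at a time, and \<open>u\<close> is updated
  whenever the path returns to \<open>C\<close>.\<close>

lemma cluster_exit:
  assumes "x \<in> S" "y \<in> cluster N (A \<inter> L) x"
  defines "C \<equiv> cluster N (A \<inter> S) x"
  shows "y \<in> C \<or> (\<exists>u\<in>C. \<exists>v\<in>N `` {u} - S. y \<in> cluster N (A \<inter> L - explored N S C) v)"
  using assms(2)
proof (induction rule: cluster_induct)
  case self
  then show ?case using assms(1) unfolding C_def by (auto intro: cluster_self)
next
  case (step y z)
  have CS: "C \<subseteq> A \<inter> S" unfolding C_def by (rule cluster_subset)
  have closed: "z \<in> C" if "u \<in> C" "(u, z) \<in> N" "z \<in> S" for u
    using cluster_step[of u N "A \<inter> S" x z] that step(3) CS unfolding C_def by auto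
  show ?case
  proof (cases "z \<in> C")
    case False
    from step(5) show ?thesis
    proof
      assume "y \<in> C"
      then have "z \<notin> S" using closed step(4) False by blast
      then have "z \<in> cluster N (A \<inter> L - explored N S C) z"
        using step(3) CS by (intro cluster_self) (auto simp: explored_def)
      with \<open>y \<in> C\<close> \<open>z \<notin> S\<close> step(4) show ?thesis by blast
    next
      assume "\<exists>u\<in>C. \<exists>v\<in>N `` {u} - S. y \<in> cluster N (A \<inter> L - explored N S C) v"
      then obtain u v where uv: "u \<in> C" "v \<in> N `` {u} - S"
        and y: "y \<in> cluster N (A \<inter> L - explored N S C) v" by blast
      have "z \<notin> explored N S C" using closed False by (auto simp: explored_def)
      moreover have "y \<in> A \<inter> L - explored N S C" using y cluster_subset by fast
      ultimately have "z \<in> cluster N (A \<inter> L - explored N S C) v"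
        using y step(3,4) by (intro cluster_step[OF y]) auto
      with uv show ?thesis by blast
    qed
  qed simp
qed

text \<open>Connections use finite paths; this makes finite windows sufficient.\<close>

lemma cluster_finitary:
  assumes "y \<in> cluster N A x"
  shows "\<exists>L. finite L \<and> L \<subseteq> A \<and> y \<in> cluster N L x"
  using assms
proof (induction rule: cluster_induct)
  case self
  then show ?case by (intro exI[of _ "{x}"]) (auto intro: cluster_self)
next
  case (step y z)
  then obtain L where L: "finite L" "L \<subseteq> A" "y \<in> cluster N L x" by blast
  have y: "y \<in> cluster N (insert z L) x" "y \<in> L"
    using L(3) cluster_mono[of L "insert z L" N x] cluster_subset[of N L x] by auto
  have "z \<in> cluster N (insert z L) x" by (rule cluster_step[OF y(1) step(4)]) (use y(2) in auto)
  then show ?case using L step(3) by (intro exI[of _ "insert z L"]) auto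
qed

section \<open>Mean cluster sizes in finite windows\<close>

definition mean_size :: "('w \<times> 'w) set \<Rightarrow> 'w set \<Rightarrow> ('w \<Rightarrow> real) \<Rightarrow> 'w \<Rightarrow> real" where
  "mean_size N L q x = bexp L q (\<lambda>A. real (card (cluster N A x)))"

text \<open>The expected number of edges that leave \<open>S\<close> from the cluster of \<open>x\<close> inside \<open>S\<close>.\<close>

definition escape :: "('w \<times> 'w) set \<Rightarrow> 'w set \<Rightarrow> ('w \<Rightarrow> real) \<Rightarrow> 'w \<Rightarrow> real" where
  "escape N S q x =
     (\<Sum>u\<in>S. \<Sum>v\<in>N `` {u} - S. bexp S q (\<lambda>A. of_bool (u \<in> cluster N A x)))"

lemma card_cluster_mono:
  assumes "A \<subseteq> B" "finite B"
  shows "card (cluster N A x) \<le> card (cluster N B x)"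
  by (intro card_mono cluster_mono assms finite_subset[OF cluster_subset])

lemma mean_size_mono:
  assumes "finite L'" "L \<subseteq> L'" "\<And>i. i \<in> L' \<Longrightarrow> 0 \<le> q i \<and> q i \<le> 1"
  shows "mean_size N L q x \<le> mean_size N L' q x"
  unfolding mean_size_def
  by (intro bexp_mono_set assms) (auto intro: card_cluster_mono finite_subset[OF _ assms(1)])

lemma mean_size_outside: "finite L \<Longrightarrow> x \<notin> L \<Longrightarrow> mean_size N L q x = 0"
  unfolding mean_size_def
  by (subst bexp_cong[where g="\<lambda>_. 0"]) (auto simp: bexp_const cluster_outside subset_eq)

text \<open>The renewal inequality. By \<open>cluster_exit\<close> every point of the cluster of \<open>x\<close> in the window \<open>L\<close> is in \<open>S\<close> or in the
  cluster of some \<open>v\<close>, just outside of \<open>S\<close>, that avoids the sites explored by \<open>C\<close>. Given \<open>C\<close>, the latter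
  cluster is independent of the past, and without the restriction to unexplored sites it has mean
  size at most \<open>m\<close>. Here \<open>S\<close> need not be contained in the window, which lets a single family of sets
  \<open>S\<close> serve all windows.\<close>

lemma mean_size_le_escape:
  fixes q :: "'w \<Rightarrow> real"
  assumes "finite S" "x \<in> S" "finite L" and locfin: "\<And>u. finite (N `` {u})"
    and q: "\<And>i. 0 \<le> q i \<and> q i \<le> 1"
    and m: "\<And>v. mean_size N L q v \<le> m" "0 \<le> m"
  shows "mean_size N L q x \<le> card S + escape N S q x * m"
proof -
  define J where "J = L \<union> S"
  have J: "finite J" "L \<subseteq> J" "S \<subseteq> J" using assms by (auto simp: J_def)
  define CC where "CC = {C. C \<subseteq> S \<and> x \<in> C}"
  have finCC: "finite CC" using assms(1) by (simp add: CC_def)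
  define c where "c C A = (of_bool (cluster N (A \<inter> S) x = C) :: real)" for C A
  define g where "g C v A = real (card (cluster N (A \<inter> L - explored N S C) v))" for C v A
  have pointwise: "real (card (cluster N (A \<inter> L) x)) \<le> real (card S) +
      (\<Sum>u\<in>S. \<Sum>v\<in>N `` {u} - S. \<Sum>C\<in>CC. of_bool (u \<in> C) * (c C A * g C v A))"
    (is "_ \<le> _ + ?rhs") for A
  proof (cases "x \<in> A")
    case False
    then have "cluster N (A \<inter> L) x = {}" by (intro cluster_outside) auto
    moreover have "0 \<le> ?rhs" by (intro sum_nonneg) (auto simp: c_def g_def)
    ultimately show ?thesis by simp
  next
    case True
    define C where "C = cluster N (A \<inter> S) x"
    let ?G = "\<lambda>v. cluster N (A \<inter> L - explored N S C) v"
    have C: "C \<subseteq> S" "x \<in> C" "C \<in> CC"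
      using cluster_subset[of N "A \<inter> S" x] cluster_self[of x "A \<inter> S" N] assms(2) True
      by (auto simp: C_def CC_def)
    have finG: "finite (?G v)" for v
      by (rule finite_subset[OF cluster_subset]) (use assms(3) in auto)
    have finC: "finite C" using C(1) assms(1) finite_subset by auto
    have "cluster N (A \<inter> L) x \<subseteq> S \<union> (\<Union>u\<in>C. \<Union>v\<in>N `` {u} - S. ?G v)"
      using cluster_exit[OF assms(2), of _ N A L] C(1) unfolding C_def by fast
    then have "card (cluster N (A \<inter> L) x) \<le> card (S \<union> (\<Union>u\<in>C. \<Union>v\<in>N `` {u} - S. ?G v))"
      by (intro card_mono) (use assms(1) finC finG locfin in auto)
    also have "\<dots> \<le> card S + card (\<Union>u\<in>C. \<Union>v\<in>N `` {u} - S. ?G v)" by (rule card_Un_le)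
    also have "card (\<Union>u\<in>C. \<Union>v\<in>N `` {u} - S. ?G v) \<le> (\<Sum>u\<in>C. card (\<Union>v\<in>N `` {u} - S. ?G v))"
      by (rule card_UN_le[OF finC])
    also have "\<dots> \<le> (\<Sum>u\<in>C. \<Sum>v\<in>N `` {u} - S. card (?G v))"
      by (intro sum_mono card_UN_le) (use locfin in auto)
    finally have bound: "real (card (cluster N (A \<inter> L) x))
        \<le> real (card S) + (\<Sum>u\<in>C. \<Sum>v\<in>N `` {u} - S. g C v A)"
      unfolding g_def by (simp flip: of_nat_sum of_nat_add)
    have pad: "(\<Sum>u\<in>C. \<Sum>v\<in>N `` {u} - S. g C v A)
        = (\<Sum>u\<in>S. \<Sum>v\<in>N `` {u} - S. of_bool (u \<in> C) * (c C A * g C v A))"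
      by (rule sum.mono_neutral_cong_left) (use C(1) assms(1) in \<open>auto simp: c_def C_def\<close>)
    have choose: "(\<Sum>u\<in>S. \<Sum>v\<in>N `` {u} - S. of_bool (u \<in> C) * (c C A * g C v A)) \<le> ?rhs"
    proof (intro sum_mono)
      fix u v
      show "of_bool (u \<in> C) * (c C A * g C v A) \<le> (\<Sum>C\<in>CC. of_bool (u \<in> C) * (c C A * g C v A))"
        by (rule member_le_sum[OF C(3) _ finCC]) (simp_all add: c_def g_def)
    qed
    show ?thesis
      by (rule order.trans[OF bound[unfolded pad] add_left_mono[OF choose]])
  qed
  \<comment> \<open>Knowing \<open>C\<close> reveals only explored sites, which \<open>g C v\<close> does not use.\<close>
  have indep: "bexp J q (\<lambda>A. c C A * g C v A) \<le> bexp J q (c C) * m" if "C \<in> CC" for C v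
  proof -
    have "bexp J q (\<lambda>A. c C A * g C v A) = bexp J q (c C) * bexp J q (g C v)"
    proof (rule bexp_indep[OF J(1), where D = "explored N S C"])
      fix A
      have "x \<in> C" using that by (simp add: CC_def)
      have "C = cluster N (A \<inter> S) x \<longleftrightarrow> C = cluster N (A \<inter> explored N S C \<inter> S) x"
        by (rule iffI; erule cluster_eq_local[OF _ \<open>x \<in> C\<close>]; blast)
      then have "cluster N (A \<inter> S) x = C \<longleftrightarrow> cluster N (A \<inter> explored N S C \<inter> S) x = C"
        by (simp only: eq_commute)
      then show "c C A = c C (A \<inter> explored N S C)" by (simp only: c_def)
      have "A \<inter> L - explored N S C = (A - explored N S C) \<inter> L - explored N S C" by auto
      then show "g C v A = g C v (A - explored N S C)" by (simp add: g_def)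
    qed
    moreover have "bexp J q (g C v) \<le> bexp J q (\<lambda>A. real (card (cluster N (A \<inter> L) v)))"
      unfolding g_def using q assms(3) by (intro bexp_mono) (auto intro: card_cluster_mono)
    moreover have "\<dots> \<le> m"
      using m(1)[of v] bexp_marginal[OF J(1,2), of q "\<lambda>A. real (card (cluster N A v))"]
      by (simp add: mean_size_def)
    moreover have "0 \<le> bexp J q (c C)"
      using q J(1) by (intro bexp_nonneg) (auto simp: c_def)
    ultimately show ?thesis by (simp add: mult_left_mono)
  qed
  \<comment> \<open>At most one \<open>C\<close> is the cluster, so the cases that contain \<open>u\<close> have total
    probability at most that of a connection to \<open>u\<close>.\<close>
  have total: "(\<Sum>C\<in>CC. of_bool (u \<in> C) * bexp J q (c C))
      \<le> bexp S q (\<lambda>A. of_bool (u \<in> cluster N A x))" for u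
  proof -
    have "(\<Sum>C\<in>CC. of_bool (u \<in> C) * bexp J q (c C))
        = bexp J q (\<lambda>A. \<Sum>C\<in>CC. of_bool (u \<in> C) * c C A)"
      by (simp add: bexp_sum bexp_cmult)
    also have "\<dots> \<le> bexp J q (\<lambda>A. of_bool (u \<in> cluster N (A \<inter> S) x))"
    proof (intro bexp_mono)
      fix A
      have "(\<Sum>C\<in>CC. of_bool (u \<in> C) * c C A)
          = (\<Sum>C\<in>CC. if C = cluster N (A \<inter> S) x then of_bool (u \<in> cluster N (A \<inter> S) x) else 0)"
        by (intro sum.cong) (auto simp: c_def)
      then show "(\<Sum>C\<in>CC. of_bool (u \<in> C) * c C A) \<le> of_bool (u \<in> cluster N (A \<inter> S) x)"
        using finCC by (simp add: sum.delta)
    qed (use q in auto)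
    also have "\<dots> = bexp S q (\<lambda>A. of_bool (u \<in> cluster N A x))"
      by (rule bexp_marginal[OF J(1,3)])
    finally show ?thesis .
  qed
  have "mean_size N L q x = bexp J q (\<lambda>A. real (card (cluster N (A \<inter> L) x)))"
    unfolding mean_size_def
    by (rule bexp_marginal[OF J(1,2), of q "\<lambda>A. real (card (cluster N A x))", symmetric])
  also have "\<dots> \<le> bexp J q (\<lambda>A. real (card S) +
      (\<Sum>u\<in>S. \<Sum>v\<in>N `` {u} - S. \<Sum>C\<in>CC. of_bool (u \<in> C) * (c C A * g C v A)))"
    by (intro bexp_mono pointwise) (use q in auto)
  also have "\<dots> = real (card S) +
      (\<Sum>u\<in>S. \<Sum>v\<in>N `` {u} - S. \<Sum>C\<in>CC. of_bool (u \<in> C) * bexp J q (\<lambda>A. c C A * g C v A))"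
    by (simp add: bexp_add bexp_const[OF J(1)] bexp_sum bexp_cmult)
  also have "\<dots> \<le> real (card S) +
      (\<Sum>u\<in>S. \<Sum>v\<in>N `` {u} - S. \<Sum>C\<in>CC. of_bool (u \<in> C) * (bexp J q (c C) * m))"
    by (intro add_left_mono sum_mono mult_left_mono indep) auto
  also have "\<dots> = real (card S) +
      (\<Sum>u\<in>S. \<Sum>v\<in>N `` {u} - S. (\<Sum>C\<in>CC. of_bool (u \<in> C) * bexp J q (c C)) * m)"
    by (simp add: sum_distrib_right mult.assoc)
  also have "\<dots> \<le> real (card S) +
      (\<Sum>u\<in>S. \<Sum>v\<in>N `` {u} - S. bexp S q (\<lambda>A. of_bool (u \<in> cluster N A x)) * m)"
    by (intro add_left_mono sum_mono mult_right_mono total m(2))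
  also have "\<dots> = real (card S) + escape N S q x * m"
    by (simp add: escape_def sum_distrib_right mult.assoc)
  finally show ?thesis .
qed

text \<open>Apply the renewal inequality at a vertex of the window with the largest mean size \<open>m\<close>. It gives
  \<open>m \<le> K + m/2\<close>, which bounds \<open>m\<close> because \<open>m\<close> is finite in a finite window.\<close>

lemma mean_size_bounded_by_escape:
  fixes q :: "'w \<Rightarrow> real"
  assumes locfin: "\<And>u. finite (N `` {u})" and q: "\<And>i. 0 \<le> q i \<and> q i \<le> 1"
    and good: "\<And>x. x \<in> W \<Longrightarrow> \<exists>S. finite S \<and> x \<in> S \<and> real (card S) \<le> K \<and> escape N S q x \<le> 1/2"
    and L: "finite L" "L \<subseteq> W" and "0 \<le> K"
  shows "mean_size N L q x \<le> 2 * K"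
proof (cases "x \<in> L")
  case False
  then show ?thesis using mean_size_outside[OF L(1)] \<open>0 \<le> K\<close> by simp
next
  case True
  have nonneg: "0 \<le> mean_size N L q v" for v
    unfolding mean_size_def using L q by (intro bexp_nonneg) auto
  have fin: "finite (mean_size N L q ` L)" "mean_size N L q ` L \<noteq> {}" using L(1) True by auto
  from Max_in[OF fin] obtain w where w: "w \<in> L" "Max (mean_size N L q ` L) = mean_size N L q w"
    by auto
  have max: "mean_size N L q v \<le> mean_size N L q w" for v
  proof (cases "v \<in> L")
    case False
    then show ?thesis using mean_size_outside[OF L(1)] nonneg by simp
  qed (use Max_ge[OF fin(1)] w(2) in auto)
  obtain S where S: "finite S" "w \<in> S" "real (card S) \<le> K" "escape N S q w \<le> 1/2"
    using good[of w] w(1) L(2) by auto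
  have "mean_size N L q w \<le> card S + escape N S q w * mean_size N L q w"
    by (rule mean_size_le_escape[OF S(1,2) L(1) locfin q max nonneg])
  also have "\<dots> \<le> K + 1/2 * mean_size N L q w"
    by (intro add_mono S(3) mult_right_mono[OF S(4)] nonneg)
  finally show ?thesis using max[of x] by simp
qed

primrec graph_ball :: "('w \<times> 'w) set \<Rightarrow> 'w \<Rightarrow> nat \<Rightarrow> 'w set" where
  "graph_ball N x 0 = {x}"
| "graph_ball N x (Suc n) = graph_ball N x n \<union> N `` graph_ball N x n"

lemma graph_ball_mono: "m \<le> n \<Longrightarrow> graph_ball N x m \<subseteq> graph_ball N x n"
  by (rule lift_Suc_mono_le[of "graph_ball N x"]) auto

lemma centre_in_graph_ball: "x \<in> graph_ball N x n"
  by (induction n) auto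

lemma graph_ball_subset: "N \<subseteq> W \<times> W \<Longrightarrow> x \<in> W \<Longrightarrow> graph_ball N x n \<subseteq> W"
  by (induction n) auto

lemma finite_graph_ball:
  assumes "\<And>u. finite (N `` {u})"
  shows "finite (graph_ball N x n)"
proof (induction n)
  case (Suc n)
  have "N `` graph_ball N x n = (\<Union>u\<in>graph_ball N x n. N `` {u})" by blast
  then show ?case using Suc assms by simp
qed simp

text \<open>Edges that leave a ball start from its outermost shell. The shells are disjoint, so the
  expected numbers of cluster points in them sum to at most \<open>K\<close>; with degrees at most \<open>d\<close>, the
  sum of \<open>escape\<close> over any number of balls of positive radius is at most \<open>d * K\<close>, and the terms
  cannot all be at least \<open>\<epsilon>\<close>.\<close>

lemma escape_ball_less:
  fixes q :: "'w \<Rightarrow> real"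
  assumes locfin: "\<And>u. finite (N `` {u})" and deg: "\<And>u. card (N `` {u}) \<le> d"
    and q: "\<And>i. 0 \<le> q i \<and> q i \<le> 1"
    and K: "\<And>n. mean_size N (graph_ball N x n) q x \<le> K" and "0 < \<epsilon>"
  shows "\<exists>n. escape N (graph_ball N x n) q x < \<epsilon>"
proof (rule ccontr)
  assume "\<not> ?thesis"
  then have big: "\<epsilon> \<le> escape N (graph_ball N x n) q x" for n by (simp add: not_less)
  note fin = finite_graph_ball[OF locfin]
  define hit where "hit n u = bexp (graph_ball N x n) q (\<lambda>A. of_bool (u \<in> cluster N A x))" for n u
  have hit_nonneg: "0 \<le> hit n u" for n u
    unfolding hit_def using fin q by (intro bexp_nonneg) auto
  have hit_mono: "hit m u \<le> hit n u" if "m \<le> n" for m n u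
    unfolding hit_def
  proof (rule bexp_mono_set[OF fin graph_ball_mono[OF that]])
    fix A B :: "'w set" assume "A \<subseteq> B"
    then show "(of_bool (u \<in> cluster N A x) :: real) \<le> of_bool (u \<in> cluster N B x)"
      using cluster_mono[of A B N x] by auto
  qed (use q in auto)
  let ?shell = "\<lambda>n. graph_ball N x (Suc n) - graph_ball N x n"
  \<comment> \<open>Neighbours of a point of the smaller ball lie in the larger one, so only the shell contributes.\<close>
  have shell: "escape N (graph_ball N x (Suc n)) q x \<le> d * (\<Sum>u\<in>?shell n. hit (Suc n) u)" for n
  proof -
    have "escape N (graph_ball N x (Suc n)) q x
        = (\<Sum>u\<in>graph_ball N x (Suc n). card (N `` {u} - graph_ball N x (Suc n)) * hit (Suc n) u)"
      by (simp add: escape_def hit_def)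
    also have "\<dots> = (\<Sum>u\<in>?shell n. card (N `` {u} - graph_ball N x (Suc n)) * hit (Suc n) u)"
    proof (rule sum.mono_neutral_right)
      show "\<forall>u\<in>graph_ball N x (Suc n) - ?shell n. card (N `` {u} - graph_ball N x (Suc n)) * hit (Suc n) u = 0"
      proof
        fix u assume "u \<in> graph_ball N x (Suc n) - ?shell n"
        then have "N `` {u} - graph_ball N x (Suc n) = {}" by auto
        then show "card (N `` {u} - graph_ball N x (Suc n)) * hit (Suc n) u = 0" by (simp only: card.empty)
      qed
    qed (use fin in blast)+
    also have "\<dots> \<le> (\<Sum>u\<in>?shell n. d * hit (Suc n) u)"
    proof (intro sum_mono mult_right_mono hit_nonneg)
      fix u
      have "card (N `` {u} - graph_ball N x (Suc n)) \<le> card (N `` {u})"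
        using locfin by (intro card_mono) auto
      then show "real (card (N `` {u} - graph_ball N x (Suc n))) \<le> real d" using deg[of u] by simp
    qed
    finally show ?thesis by (simp add: sum_distrib_left)
  qed
  have "M * \<epsilon> \<le> d * K" for M :: nat
  proof -
    \<comment> \<open>The first \<open>m\<close> shells are disjoint subsets of the ball of radius \<open>m\<close>.\<close>
    have part: "(\<Sum>n<m. \<Sum>u\<in>?shell n. hit M u) \<le> (\<Sum>u\<in>graph_ball N x m. hit M u)" for m
    proof (induction m)
      case 0
      show ?case using hit_nonneg by simp
    next
      case (Suc m)
      have "(\<Sum>u\<in>graph_ball N x (Suc m). hit M u) = (\<Sum>u\<in>?shell m. hit M u) + (\<Sum>u\<in>graph_ball N x m. hit M u)"
        by (rule sum.subset_diff[OF graph_ball_mono fin]) simp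
      then show ?case using Suc by simp
    qed
    have "M * \<epsilon> = (\<Sum>n<M. \<epsilon>)" by simp
    also have "\<dots> \<le> (\<Sum>n<M. d * (\<Sum>u\<in>?shell n. hit (Suc n) u))"
      by (intro sum_mono order.trans[OF big shell])
    also have "\<dots> \<le> (\<Sum>n<M. d * (\<Sum>u\<in>?shell n. hit M u))"
      by (intro sum_mono mult_left_mono hit_mono) auto
    also have "\<dots> = d * (\<Sum>n<M. \<Sum>u\<in>?shell n. hit M u)" by (simp add: sum_distrib_left)
    also have "\<dots> \<le> d * (\<Sum>u\<in>graph_ball N x M. hit M u)"
      by (intro mult_left_mono part) auto
    also have "(\<Sum>u\<in>graph_ball N x M. hit M u)
        = bexp (graph_ball N x M) q (\<lambda>A. \<Sum>u\<in>graph_ball N x M. of_bool (u \<in> cluster N A x))"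
      by (simp add: hit_def bexp_sum)
    also have "\<dots> = mean_size N (graph_ball N x M) q x"
      unfolding mean_size_def
    proof (rule bexp_cong)
      fix A assume "A \<subseteq> graph_ball N x M"
      then have "graph_ball N x M \<inter> cluster N A x = cluster N A x" using cluster_subset[of N A x] by auto
      then show "(\<Sum>u\<in>graph_ball N x M. of_bool (u \<in> cluster N A x)) = real (card (cluster N A x))"
        using fin by (simp add: sum_of_bool_eq Int_def[symmetric] Collect_conj_eq)
    qed
    also have "d * \<dots> \<le> d * K" by (intro mult_left_mono K) auto
    finally show ?thesis .
  qed
  moreover obtain M :: nat where "d * K < M * \<epsilon>" using reals_Archimedean3[OF \<open>0 < \<epsilon>\<close>] by blast
  ultimately show False by (meson not_less)
qed

text \<open>With probability \<open>q x\<close> the site \<open>x\<close> is open, independently of the other sites, and then its cluster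
  absorbs that of \<open>z\<close>. In a connected graph this carries finiteness of the mean size from
  one vertex to all others when all weights are positive.\<close>

lemma mean_size_neighbour:
  assumes "(x, z) \<in> N" "finite L" and q: "\<And>i. 0 \<le> q i \<and> q i \<le> 1"
  shows "q x * mean_size N L q z \<le> mean_size N (insert x L) q x"
proof -
  \<comment> \<open>Whatever the state of \<open>x\<close>, the cluster of \<open>z\<close> has conditional mean at most \<open>b\<close>, the mean size
    of the cluster that \<open>x\<close> has once it is opened.\<close>
  define M where "M = L - {x}"
  have M: "finite M" "x \<notin> M" "insert x L = insert x M" using assms(2) by (auto simp: M_def)
  have fin: "finite (insert x A)" if "A \<subseteq> M" for A using that M(1) finite_subset by auto
  define b where "b = bexp M q (\<lambda>A. real (card (cluster N (insert x A) x)))"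
  have le: "card (cluster N A z) \<le> card (cluster N (insert x A) x)" if "finite A" for A
    by (intro card_mono cluster_neighbour assms(1) finite_subset[OF cluster_subset]) (use that in auto)
  have "mean_size N L q z \<le> mean_size N (insert x M) q z"
    unfolding M(3)[symmetric] by (intro mean_size_mono) (use assms in auto)
  also have "\<dots> = q x * bexp M q (\<lambda>A. real (card (cluster N (insert x A) z)))
      + (1 - q x) * bexp M q (\<lambda>A. real (card (cluster N A z)))"
    unfolding mean_size_def by (rule bexp_insert[OF M(1,2)])
  also have "\<dots> \<le> q x * b + (1 - q x) * b"
    unfolding b_def
  proof (intro add_mono mult_left_mono bexp_mono)
    fix A assume "A \<subseteq> M"
    show "real (card (cluster N A z)) \<le> real (card (cluster N (insert x A) x))"
      using le[of A] fin[OF \<open>A \<subseteq> M\<close>] by simp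
    show "real (card (cluster N (insert x A) z)) \<le> real (card (cluster N (insert x A) x))"
      using le[of "insert x A"] fin[OF \<open>A \<subseteq> M\<close>] by simp
  qed (use q in auto)
  finally have "mean_size N L q z \<le> b" by (simp add: algebra_simps)
  then have "q x * mean_size N L q z \<le> q x * b" using q by (intro mult_left_mono) auto
  also have "\<dots> \<le> mean_size N (insert x M) q x"
  proof -
    have "0 \<le> (1 - q x) * bexp M q (\<lambda>A. real (card (cluster N A x)))"
      using q M(1) by (intro mult_nonneg_nonneg bexp_nonneg) auto
    then show ?thesis unfolding mean_size_def b_def bexp_insert[OF M(1,2)] by simp
  qed
  finally show ?thesis by (simp add: M(3))
qed

lemma escape_image:
  fixes q :: "'w \<Rightarrow> real"
  assumes "N \<subseteq> W \<times> W" "bij_betw h W W" "\<And>u v. u \<in> W \<Longrightarrow> v \<in> W \<Longrightarrow> (h u, h v) \<in> N \<longleftrightarrow> (u, v) \<in> N"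
    and "\<And>u. u \<in> W \<Longrightarrow> q (h u) = q u" and "finite S" "S \<subseteq> W" "x \<in> W"
  shows "escape N (h ` S) q (h x) = escape N S q x"
proof -
  have inj: "inj_on h W" and im: "h ` W = W"
    using assms(2) by (auto simp: bij_betw_def)
  have injS: "inj_on h S" using inj assms(6) inj_on_subset by blast
  have nbrs: "N `` {h u} - h ` S = h ` (N `` {u} - S)" if "u \<in> S" for u
  proof -
    have "N `` {h u} = h ` (N `` {u})"
    proof (intro subset_antisym subsetI)
      fix w assume w: "w \<in> N `` {h u}"
      then have "w \<in> W" using assms(1) by auto
      then obtain v where "v \<in> W" "w = h v" using im by blast
      then show "w \<in> h ` (N `` {u})" using w assms(3)[of u v] that assms(6) by auto
    next
      fix w assume "w \<in> h ` (N `` {u})"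
      then show "w \<in> N `` {h u}" using assms(1) assms(3)[of u] by auto
    qed
    also have "\<dots> - h ` S = h ` (N `` {u} - S)"
      by (rule inj_on_image_set_diff[OF inj, symmetric]) (use assms(1,6) in auto)
    finally show ?thesis .
  qed
  have hit: "bexp (h ` S) q (\<lambda>A. of_bool (h u \<in> cluster N A (h x)))
      = bexp S q (\<lambda>A. of_bool (u \<in> cluster N A x))" if "u \<in> S" for u
  proof -
    have "bexp (h ` S) q (\<lambda>A. of_bool (h u \<in> cluster N A (h x)))
        = bexp S (\<lambda>i. q (h i)) (\<lambda>A. of_bool (h u \<in> cluster N (h ` A) (h x)))"
      by (rule bexp_reindex[OF injS assms(5)])
    also have "\<dots> = bexp S (\<lambda>i. q (h i)) (\<lambda>A. of_bool (u \<in> cluster N A x))"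
    proof (rule bexp_cong)
      fix A assume "A \<subseteq> S"
      have "A \<subseteq> W" using \<open>A \<subseteq> S\<close> assms(6) by auto
      have "cluster N (h ` A) (h x) = h ` cluster N A x"
        by (rule cluster_image[OF inj \<open>A \<subseteq> W\<close> assms(7)]) (rule assms(3))
      moreover have "cluster N A x \<subseteq> W" using cluster_subset[of N A x] \<open>A \<subseteq> W\<close> by auto
      ultimately have "h u \<in> cluster N (h ` A) (h x) \<longleftrightarrow> u \<in> cluster N A x"
        using inj_on_image_mem_iff[OF inj, of u "cluster N A x"] that assms(6) by auto
      then show "(of_bool (h u \<in> cluster N (h ` A) (h x)) :: real) = of_bool (u \<in> cluster N A x)"
        by simp
    qed
    also have "\<dots> = bexp S q (\<lambda>A. of_bool (u \<in> cluster N A x))"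
      unfolding bexp_def
      by (intro sum.cong arg_cong2[where f="(*)"] prod.cong) (use assms(4,6) in auto)
    finally show ?thesis .
  qed
  have "escape N (h ` S) q (h x)
      = (\<Sum>u\<in>S. \<Sum>v\<in>N `` {h u} - h ` S. bexp (h ` S) q (\<lambda>A. of_bool (h u \<in> cluster N A (h x))))"
    unfolding escape_def by (rule sum.reindex_cong[OF injS]) auto
  also have "\<dots> = (\<Sum>u\<in>S. \<Sum>v\<in>N `` {u} - S. bexp S q (\<lambda>A. of_bool (u \<in> cluster N A x)))"
  proof (rule sum.cong[OF refl])
    fix u assume u: "u \<in> S"
    have "N `` {u} - S \<subseteq> W" using assms(1) by auto
    then have "inj_on h (N `` {u} - S)" using inj inj_on_subset by blast
    then show "(\<Sum>v\<in>N `` {h u} - h ` S. bexp (h ` S) q (\<lambda>A. of_bool (h u \<in> cluster N A (h x))))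
        = (\<Sum>v\<in>N `` {u} - S. bexp S q (\<lambda>A. of_bool (u \<in> cluster N A x)))"
      unfolding hit[OF u] nbrs[OF u] by (simp add: card_image)
  qed
  finally show ?thesis by (simp add: escape_def)
qed

section \<open>The critical point of site percolation with some sites always open\<close>

text \<open>Site percolation on a quasi-transitive graph in which only the sites of \<open>I\<close> are random.
  Quasi-transitivity refers to automorphisms that preserve \<open>I\<close>, and \<open>R\<close> represents their orbits. The
  last assumption says that the mean cluster size is finite at parameter \<open>0\<close>, where exactly the sites outside of
  \<open>I\<close> are open.\<close>

locale percolation_graph =
  fixes W :: "'w set" and N :: "('w \<times> 'w) set" and I :: "'w set"
  assumes edges: "N \<subseteq> W \<times> W"
    and infinite_graph: "infinite W"
    and locfin: "\<And>u. finite (N `` {u})"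
    and connected: "\<And>x y. x \<in> W \<Longrightarrow> y \<in> W \<Longrightarrow> (x, y) \<in> N\<^sup>*"
    and random_sites: "I \<subseteq> W"
    and finitely_many_orbits: "\<exists>R. finite R \<and> R \<subseteq> W \<and> (\<forall>x\<in>W. \<exists>r\<in>R. \<exists>h. bij_betw h W W \<and> h r = x \<and>
      (\<forall>u\<in>W. \<forall>v\<in>W. (h u, h v) \<in> N \<longleftrightarrow> (u, v) \<in> N) \<and> (\<forall>u\<in>W. h u \<in> I \<longleftrightarrow> u \<in> I))"
    and always_open_cluster_finite: "\<And>x. x \<in> W \<Longrightarrow> finite (cluster N (W - I) x)"
begin

definition weight :: "real \<Rightarrow> 'w \<Rightarrow> real" where
  "weight p i = (if i \<in> I then p else 1)"

definition susceptibility :: "real \<Rightarrow> 'w \<Rightarrow> ennreal" where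
  "susceptibility p x = (SUP L\<in>{L. finite L \<and> L \<subseteq> W}. ennreal (mean_size N L (weight p) x))"

lemma weight_bounds: "p \<in> {0..1} \<Longrightarrow> 0 \<le> weight p i \<and> weight p i \<le> 1"
  by (auto simp: weight_def)

lemma isCont_weight: "isCont (\<lambda>p. weight p i) p0"
  by (cases "i \<in> I") (auto simp: weight_def)

lemma mean_size_le_susceptibility:
  "finite L \<Longrightarrow> L \<subseteq> W \<Longrightarrow> ennreal (mean_size N L (weight p) x) \<le> susceptibility p x"
  unfolding susceptibility_def by (rule SUP_upper) auto

lemma susceptibility_finite_iff:
  "susceptibility p x < \<infinity> \<longleftrightarrow> (\<exists>K. \<forall>L. finite L \<longrightarrow> L \<subseteq> W \<longrightarrow> mean_size N L (weight p) x \<le> K)"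
proof
  assume fin: "susceptibility p x < \<infinity>"
  have "mean_size N L (weight p) x \<le> enn2real (susceptibility p x)" if "finite L" "L \<subseteq> W" for L
    using enn2real_mono[OF mean_size_le_susceptibility[OF that, of p x]] fin
    by (cases "0 \<le> mean_size N L (weight p) x") (auto intro: order.trans[OF _ enn2real_nonneg])
  then show "\<exists>K. \<forall>L. finite L \<longrightarrow> L \<subseteq> W \<longrightarrow> mean_size N L (weight p) x \<le> K" by blast
next
  assume "\<exists>K. \<forall>L. finite L \<longrightarrow> L \<subseteq> W \<longrightarrow> mean_size N L (weight p) x \<le> K"
  then obtain K where K: "finite L \<Longrightarrow> L \<subseteq> W \<Longrightarrow> mean_size N L (weight p) x \<le> K" for L by blast
  have "susceptibility p x \<le> ennreal K"
    unfolding susceptibility_def by (intro SUP_least ennreal_leI K) auto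
  then show "susceptibility p x < \<infinity>" by (simp add: order_le_less_trans)
qed

lemma bounded_degree: "\<exists>d. \<forall>u. card (N `` {u}) \<le> d"
proof -
  obtain R where R: "finite R" "R \<subseteq> W"
    "\<And>x. x \<in> W \<Longrightarrow> \<exists>r\<in>R. \<exists>h. bij_betw h W W \<and> h r = x \<and>
      (\<forall>u\<in>W. \<forall>v\<in>W. (h u, h v) \<in> N \<longleftrightarrow> (u, v) \<in> N) \<and> (\<forall>u\<in>W. h u \<in> I \<longleftrightarrow> u \<in> I)"
    using finitely_many_orbits by metis
  have "card (N `` {u}) \<le> (\<Sum>r\<in>R. card (N `` {r}))" for u
  proof (cases "u \<in> W")
    case True
    then obtain r h where r: "r \<in> R" "bij_betw h W W" "h r = u"
      "\<And>u v. u \<in> W \<Longrightarrow> v \<in> W \<Longrightarrow> (h u, h v) \<in> N \<longleftrightarrow> (u, v) \<in> N"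
      using R(3) by metis
    have "N `` {u} \<subseteq> h ` (N `` {r})"
    proof
      fix w assume w: "w \<in> N `` {u}"
      then obtain v where "v \<in> W" "w = h v" using edges r(2) unfolding bij_betw_def by blast
      then show "w \<in> h ` (N `` {r})" using w r(1,3) r(4)[of r v] R(2) by auto
    qed
    then have "card (N `` {u}) \<le> card (N `` {r})" using locfin by (meson surj_card_le)
    also have "\<dots> \<le> (\<Sum>r\<in>R. card (N `` {r}))" using r(1) R(1) by (intro member_le_sum) auto
    finally show ?thesis .
  next
    case False
    then have "N `` {u} = {}" using edges by auto
    then show ?thesis by simp
  qed
  then show ?thesis by blast
qed

lemma susceptibility_finite_neighbour:
  assumes "0 < p" "p \<le> 1" "(x, z) \<in> N" "susceptibility p x < \<infinity>"
  shows "susceptibility p z < \<infinity>"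
proof -
  obtain K where K: "\<And>L. finite L \<Longrightarrow> L \<subseteq> W \<Longrightarrow> mean_size N L (weight p) x \<le> K"
    using assms(4) unfolding susceptibility_finite_iff by blast
  have pos: "0 < weight p x" using assms(1) by (simp add: weight_def)
  have "mean_size N L (weight p) z \<le> K / weight p x" if "finite L" "L \<subseteq> W" for L
  proof -
    have "weight p x * mean_size N L (weight p) z \<le> mean_size N (insert x L) (weight p) x"
      using assms weight_bounds[of p] that by (intro mean_size_neighbour) auto
    also have "\<dots> \<le> K" using that edges assms(3) by (intro K) auto
    finally show ?thesis using pos by (simp add: field_simps)
  qed
  then show ?thesis unfolding susceptibility_finite_iff by blast
qed

lemma susceptibility_finite_everywhere:
  assumes "0 < p" "p \<le> 1" "x \<in> W" "z \<in> W" "susceptibility p x < \<infinity>"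
  shows "susceptibility p z < \<infinity>"
  using connected[OF assms(3,4)]
  by (induction rule: rtrancl_induct)
    (use assms susceptibility_finite_neighbour in blast)+

lemma susceptibility_zero:
  assumes "x \<in> W"
  shows "susceptibility 0 x < \<infinity>"
proof -
  have "mean_size N L (weight 0) x \<le> card (cluster N (W - I) x)" if "finite L" "L \<subseteq> W" for L
  proof -
    \<comment> \<open>At parameter \<open>0\<close> the sites of \<open>I\<close> are closed.\<close>
    have "mean_size N L (weight 0) x = mean_size N ((L - I) \<union> (L \<inter> I)) (weight 0) x"
      by (simp add: Un_Diff_Int)
    also have "\<dots> = bexp (L - I) (weight 0) (\<lambda>A. real (card (cluster N A x)))"
      unfolding mean_size_def by (rule bexp_impossible) (use that in \<open>auto simp: weight_def\<close>)
    also have "\<dots> \<le> bexp (L - I) (weight 0) (\<lambda>_. real (card (cluster N (W - I) x)))"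
    proof (rule bexp_mono)
      fix A assume "A \<subseteq> L - I"
      then have "cluster N A x \<subseteq> cluster N (W - I) x" using that by (intro cluster_mono) auto
      then show "real (card (cluster N A x)) \<le> real (card (cluster N (W - I) x))"
        using card_mono[OF always_open_cluster_finite[OF assms]] by simp
    qed (use weight_bounds in auto)
    also have "\<dots> = real (card (cluster N (W - I) x))" using that by (simp add: bexp_const)
    finally show ?thesis .
  qed
  then show ?thesis unfolding susceptibility_finite_iff by blast
qed

lemma susceptibility_one:
  assumes "x \<in> W"
  shows "susceptibility 1 x = \<infinity>"
proof (rule ccontr)
  assume "susceptibility 1 x \<noteq> \<infinity>"
  then have "susceptibility 1 x < \<infinity>" by (simp add: less_top)
  then obtain K where K: "\<And>L. finite L \<Longrightarrow> L \<subseteq> W \<Longrightarrow> mean_size N L (weight 1) x \<le> K"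
    unfolding susceptibility_finite_iff by blast
  have all: "y \<in> cluster N W x" if "y \<in> W" for y
    using connected[OF assms that] edges assms by (simp add: cluster_def Int_absorb2)
  obtain F where F: "finite F" "F \<subseteq> W" "card F = nat \<lceil>K\<rceil> + 1"
    using infinite_arbitrarily_large[OF infinite_graph] by blast
  have "\<forall>y\<in>F. \<exists>L. finite L \<and> L \<subseteq> W \<and> y \<in> cluster N L x"
    using cluster_finitary[OF all] F(2) by blast
  then obtain L where L: "\<forall>y\<in>F. finite (L y) \<and> L y \<subseteq> W \<and> y \<in> cluster N (L y) x"
    by metis
  let ?L = "\<Union>y\<in>F. L y"
  have fin: "finite ?L" "?L \<subseteq> W" using L F(1) by auto
  have "F \<subseteq> cluster N ?L x"
  proof
    fix y assume "y \<in> F"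
    then have "cluster N (L y) x \<subseteq> cluster N ?L x" by (intro cluster_mono) auto
    then show "y \<in> cluster N ?L x" using L \<open>y \<in> F\<close> by auto
  qed
  then have "card F \<le> card (cluster N ?L x)"
    by (intro card_mono finite_subset[OF cluster_subset fin(1)])
  moreover have "mean_size N ?L (weight 1) x = card (cluster N ?L x)"
    using bexp_certain[of "{}" ?L "weight 1" "\<lambda>A. real (card (cluster N A x))"] fin(1)
    by (simp add: mean_size_def weight_def)
  ultimately have "real (nat \<lceil>K\<rceil> + 1) \<le> K" using K[OF fin] F(3) by simp
  then show False by linarith
qed

lemma exists_good_set:
  assumes "p \<in> {0..1}" "x \<in> W" "susceptibility p x < \<infinity>"
  shows "\<exists>S. finite S \<and> S \<subseteq> W \<and> x \<in> S \<and> escape N S (weight p) x < 1/2"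
proof -
  obtain d where d: "\<And>u. card (N `` {u}) \<le> d" using bounded_degree by blast
  obtain K where K: "\<And>L. finite L \<Longrightarrow> L \<subseteq> W \<Longrightarrow> mean_size N L (weight p) x \<le> K"
    using assms(3) unfolding susceptibility_finite_iff by blast
  have "\<exists>n. escape N (graph_ball N x n) (weight p) x < 1/2"
    by (rule escape_ball_less[OF locfin d weight_bounds[OF assms(1)]
          K[OF finite_graph_ball[OF locfin] graph_ball_subset[OF edges assms(2)]]]) simp
  then show ?thesis
    using finite_graph_ball[OF locfin] graph_ball_subset[OF edges assms(2)] centre_in_graph_ball by metis
qed

text \<open>A set \<open>S\<close> with \<open>escape\<close> below \<open>1/2\<close> keeps this property when the parameter increases a little. For
  finitely many orbit representatives one increase works for all of them, and automorphisms carry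
  the sets to all other vertices.\<close>

lemma susceptibility_finite_open:
  assumes p: "0 \<le> p" "p < 1" and finite_at_p: "\<And>x. x \<in> W \<Longrightarrow> susceptibility p x < \<infinity>"
  shows "\<exists>p'\<in>{p<..1}. \<forall>x\<in>W. susceptibility p' x < \<infinity>"
proof -
  obtain R where R: "finite R" "R \<subseteq> W"
    "\<And>x. x \<in> W \<Longrightarrow> \<exists>r\<in>R. \<exists>h. bij_betw h W W \<and> h r = x \<and>
      (\<forall>u\<in>W. \<forall>v\<in>W. (h u, h v) \<in> N \<longleftrightarrow> (u, v) \<in> N) \<and> (\<forall>u\<in>W. h u \<in> I \<longleftrightarrow> u \<in> I)"
    using finitely_many_orbits by metis
  have "\<forall>r\<in>R. \<exists>S. finite S \<and> S \<subseteq> W \<and> r \<in> S \<and> escape N S (weight p) r < 1/2"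
    using exists_good_set[of p] p R(2) finite_at_p by auto
  then obtain S where S: "\<forall>r\<in>R. finite (S r) \<and> S r \<subseteq> W \<and> r \<in> S r \<and> escape N (S r) (weight p) r < 1/2"
    by metis
  have "eventually (\<lambda>p'. escape N (S r) (weight p') r < 1/2) (at_right p)" if "r \<in> R" for r
  proof -
    have "isCont (\<lambda>p'. escape N (S r) (weight p') r) p"
      unfolding escape_def by (intro continuous_intros isCont_bexp isCont_weight)
    then have "((\<lambda>p'. escape N (S r) (weight p') r) \<longlongrightarrow> escape N (S r) (weight p) r) (at_right p)"
      using isCont_def tendsto_within_subset by blast
    then show ?thesis using S that by (intro order_tendstoD) auto
  qed
  then have "eventually (\<lambda>p'. \<forall>r\<in>R. escape N (S r) (weight p') r < 1/2) (at_right p)"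
    using R(1) by (intro eventually_ball_finite) auto
  moreover have "eventually (\<lambda>p'. p' \<in> {p<..<1}) (at_right p)"
    using eventually_at_right_real[OF p(2)] by simp
  ultimately obtain p' where p': "p' \<in> {p<..<1}" "\<forall>r\<in>R. escape N (S r) (weight p') r < 1/2"
    using eventually_happens[OF eventually_conj] trivial_limit_at_right_real by blast
  define K where "K = (\<Sum>r\<in>R. real (card (S r)))"
  have good: "\<exists>T. finite T \<and> x \<in> T \<and> real (card T) \<le> K \<and> escape N T (weight p') x \<le> 1/2"
    if xW: "x \<in> W" for x
  proof -
    obtain r h where r: "r \<in> R" "bij_betw h W W" "h r = x"
      "\<And>u v. u \<in> W \<Longrightarrow> v \<in> W \<Longrightarrow> (h u, h v) \<in> N \<longleftrightarrow> (u, v) \<in> N"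
      "\<And>u. u \<in> W \<Longrightarrow> h u \<in> I \<longleftrightarrow> u \<in> I"
      using R(3)[OF xW] by metis
    then have w: "weight p' (h u) = weight p' u" if "u \<in> W" for u
      using that by (simp add: weight_def)
    have Sr: "finite (S r)" "S r \<subseteq> W" "r \<in> S r" using S r(1) by auto
    have "escape N (h ` S r) (weight p') (h r) = escape N (S r) (weight p') r"
      by (rule escape_image[OF edges r(2)]) (use r(4) w Sr in auto)
    moreover have "card (h ` S r) \<le> card (S r)" using Sr by (simp add: card_image_le)
    moreover have "real (card (S r)) \<le> K"
      unfolding K_def using R(1) r(1) by (intro member_le_sum) auto
    ultimately show ?thesis
      using Sr r(1,3) p'(2) by (intro exI[of _ "h ` S r"]) force
  qed
  have "0 \<le> K" by (simp add: K_def sum_nonneg)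
  have "mean_size N L (weight p') x \<le> 2 * K" if "finite L" "L \<subseteq> W" for L x
    using p p'(1) that weight_bounds[of p'] \<open>0 \<le> K\<close>
    by (intro mean_size_bounded_by_escape[OF locfin _ good]) auto
  then have "\<forall>x\<in>W. susceptibility p' x < \<infinity>" unfolding susceptibility_finite_iff by blast
  then show ?thesis using p'(1) by (intro bexI[of _ p']) auto
qed

text \<open>A window whose mean size exceeds \<open>l\<close> at \<open>p0\<close> has this property also at nearby parameters.\<close>

lemma susceptibility_lower_semicontinuous:
  assumes "susceptibility p0 x = \<infinity>"
  shows "((\<lambda>p. susceptibility p x) \<longlongrightarrow> \<infinity>) (at p0 within T)"
  unfolding infinity_ennreal_def tendsto_top_iff_ennreal
proof (intro allI impI)
  fix l :: real assume "0 \<le> l"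
  obtain L where L: "finite L" "L \<subseteq> W" "l < mean_size N L (weight p0) x"
    using assms susceptibility_finite_iff[of p0 x] by (metis less_irrefl not_le)
  have "isCont (\<lambda>p. mean_size N L (weight p) x) p0"
    unfolding mean_size_def by (intro isCont_bexp isCont_weight)
  then have "((\<lambda>p. mean_size N L (weight p) x) \<longlongrightarrow> mean_size N L (weight p0) x) (at p0 within T)"
    using isCont_def tendsto_within_subset by blast
  from order_tendstoD(1)[OF this L(3)]
  show "eventually (\<lambda>p. ennreal l < susceptibility p x) (at p0 within T)"
  proof eventually_elim
    case (elim p)
    then have "ennreal l < ennreal (mean_size N L (weight p) x)" using \<open>0 \<le> l\<close> by (simp add: ennreal_lessI)
    then show ?case using mean_size_le_susceptibility[OF L(1,2)] order_less_le_trans by blast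
  qed
qed

text \<open>If the susceptibility were finite at \<open>pT\<close>, then it would be finite at a larger parameter. At \<open>0\<close>,
  where it is finite, the same argument shows that \<open>pT\<close> is positive, so that the left limit at \<open>pT\<close>
  only concerns genuine probabilities.\<close>

theorem susceptibility_infinite_at_critical:
  assumes "z \<in> W" "x \<in> W"
  defines "pT \<equiv> Sup {p \<in> {0..1}. susceptibility p z < \<infinity>}"
  shows "0 < pT \<and> pT \<le> 1 \<and> susceptibility pT x = \<infinity> \<and> ((\<lambda>p. susceptibility p x) \<longlongrightarrow> \<infinity>) (at_left pT)"
proof -
  let ?S = "{p \<in> {0..1}. susceptibility p z < \<infinity>}"
  have bdd: "bdd_above ?S" by (rule bdd_aboveI[of _ 1]) auto
  have upper: "p \<le> pT" if "p \<in> ?S" for p unfolding pT_def using that bdd by (rule cSup_upper)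
  have "0 \<in> ?S" using susceptibility_zero[OF assms(1)] by simp
  have le1: "pT \<le> 1" unfolding pT_def
  proof (rule cSup_least)
    show "?S \<noteq> {}" using \<open>0 \<in> ?S\<close> by blast
  qed auto
  obtain p1 where "p1 \<in> {0<..1}" "\<forall>x\<in>W. susceptibility p1 x < \<infinity>"
    using susceptibility_finite_open[of 0] susceptibility_zero by auto
  then have pos: "0 < pT" using upper[of p1] assms(1) by auto
  have inf: "susceptibility pT x = \<infinity>"
  proof (rule ccontr)
    assume "susceptibility pT x \<noteq> \<infinity>"
    then have fin: "susceptibility pT x < \<infinity>" by (simp add: less_top)
    then have "pT < 1" using susceptibility_one[OF assms(2)] le1 by (cases "pT = 1") auto
    then obtain p' where "p' \<in> {pT<..1}" "\<forall>x\<in>W. susceptibility p' x < \<infinity>"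
      using susceptibility_finite_open[of pT] susceptibility_finite_everywhere[OF pos le1 assms(2) _ fin] pos
      by auto
    then show False using upper[of p'] pos assms(1) by auto
  qed
  show ?thesis using pos le1 inf susceptibility_lower_semicontinuous by blast
qed

end

section \<open>The product measure on all configurations\<close>

text \<open>The weights in \<open>bexp\<close> are the probabilities of the finite-dimensional cylinders.\<close>

lemma bernoulli_product_cylinder:
  assumes "finite J" "J \<subseteq> I" "p \<in> {0..1}" "A \<subseteq> J"
  shows "{\<omega> \<in> space (bernoulli_product I p). {i \<in> J. \<omega> i} = A} \<in> sets (bernoulli_product I p)"
    and "emeasure (bernoulli_product I p) {\<omega> \<in> space (bernoulli_product I p). {i \<in> J. \<omega> i} = A}
      = ennreal (p ^ card A * (1 - p) ^ card (J - A))"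
proof -
  interpret product_prob_space "\<lambda>_. measure_pmf (bernoulli_pmf p)" I
    by unfold_locales
  let ?M = "bernoulli_product I p"
  have eq: "{\<omega> \<in> space ?M. {i \<in> J. \<omega> i} = A} = {\<omega> \<in> space ?M. \<forall>i\<in>J. \<omega> i \<in> {i \<in> A}}"
    using assms(4) by auto
  show "{\<omega> \<in> space ?M. {i \<in> J. \<omega> i} = A} \<in> sets ?M"
    unfolding eq unfolding bernoulli_product_def using assms(1,2)
    by (intro sets.sets_Collect_finite_All sets_Collect_single) auto
  have "emeasure ?M {\<omega> \<in> space ?M. {i \<in> J. \<omega> i} = A}
      = (\<Prod>i\<in>J. emeasure (measure_pmf (bernoulli_pmf p)) {i \<in> A})"
    unfolding eq unfolding bernoulli_product_def using assms(1,2) by (intro emeasure_PiM_Collect) auto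
  also have "\<dots> = (\<Prod>i\<in>J. ennreal (if i \<in> A then p else 1 - p))"
    using assms(3) by (intro prod.cong) (auto simp: emeasure_pmf_single)
  also have "\<dots> = ennreal (\<Prod>i\<in>J. if i \<in> A then p else 1 - p)"
    using assms(3) by (intro prod_ennreal) auto
  also have "(\<Prod>i\<in>J. if i \<in> A then p else 1 - p) = p ^ card A * (1 - p) ^ card (J - A)"
    using assms(1,4) by (simp add: prod.If_cases Int_absorb1 Diff_eq)
  finally show "emeasure ?M {\<omega> \<in> space ?M. {i \<in> J. \<omega> i} = A}
      = ennreal (p ^ card A * (1 - p) ^ card (J - A))" .
qed

lemma
  assumes J: "finite J" "J \<subseteq> I" and p: "p \<in> {0..1}" and nonneg: "\<And>A. 0 \<le> f A"
  shows borel_measurable_local: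
      "(\<lambda>\<omega>. ennreal (f {i \<in> J. \<omega> i})) \<in> borel_measurable (bernoulli_product I p)"
    and nn_integral_local:
      "(\<integral>\<^sup>+\<omega>. ennreal (f {i \<in> J. \<omega> i}) \<partial>bernoulli_product I p) = ennreal (bexp J (\<lambda>_. p) f)"
proof -
  let ?M = "bernoulli_product I p"
  define cyl where "cyl A = {\<omega> \<in> space ?M. {i \<in> J. \<omega> i} = A}" for A
  have cyl: "cyl A \<in> sets ?M" if "A \<in> Pow J" for A
    unfolding cyl_def using bernoulli_product_cylinder(1)[OF J p] that by auto
  have decomp: "ennreal (f {i \<in> J. \<omega> i}) = (\<Sum>A\<in>Pow J. ennreal (f A) * indicator (cyl A) \<omega>)"
    if "\<omega> \<in> space ?M" for \<omega>
  proof -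
    have "(\<Sum>A\<in>Pow J. ennreal (f A) * indicator (cyl A) \<omega>)
        = (\<Sum>A\<in>Pow J. if A = {i \<in> J. \<omega> i} then ennreal (f A) else 0)"
      using that by (intro sum.cong) (auto simp: cyl_def indicator_def)
    also have "\<dots> = ennreal (f {i \<in> J. \<omega> i})" using J(1) by (simp add: sum.delta')
    finally show ?thesis by simp
  qed
  have meas: "(\<lambda>\<omega>. \<Sum>A\<in>Pow J. ennreal (f A) * indicator (cyl A) \<omega>) \<in> borel_measurable ?M"
    by (intro borel_measurable_sum borel_measurable_times_ennreal borel_measurable_const
        borel_measurable_indicator cyl)
  then show "(\<lambda>\<omega>. ennreal (f {i \<in> J. \<omega> i})) \<in> borel_measurable ?M"
    by (subst measurable_cong[OF decomp])
  have "(\<integral>\<^sup>+\<omega>. ennreal (f {i \<in> J. \<omega> i}) \<partial>?M)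
      = (\<integral>\<^sup>+\<omega>. (\<Sum>A\<in>Pow J. ennreal (f A) * indicator (cyl A) \<omega>) \<partial>?M)"
    by (rule nn_integral_cong[OF decomp])
  also have "\<dots> = (\<Sum>A\<in>Pow J. \<integral>\<^sup>+\<omega>. ennreal (f A) * indicator (cyl A) \<omega> \<partial>?M)"
    by (intro nn_integral_sum borel_measurable_times_ennreal borel_measurable_const
        borel_measurable_indicator cyl)
  also have "\<dots> = (\<Sum>A\<in>Pow J. ennreal (p ^ card A * (1 - p) ^ card (J - A) * f A))"
  proof (rule sum.cong[OF refl])
    fix A assume A: "A \<in> Pow J"
    have "(\<integral>\<^sup>+\<omega>. ennreal (f A) * indicator (cyl A) \<omega> \<partial>?M) = ennreal (f A) * emeasure ?M (cyl A)"
      by (rule nn_integral_cmult_indicator[OF cyl[OF A]])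
    also have "emeasure ?M (cyl A) = ennreal (p ^ card A * (1 - p) ^ card (J - A))"
      unfolding cyl_def using bernoulli_product_cylinder(2)[OF J p] A by auto
    finally show "(\<integral>\<^sup>+\<omega>. ennreal (f A) * indicator (cyl A) \<omega> \<partial>?M)
        = ennreal (p ^ card A * (1 - p) ^ card (J - A) * f A)"
      using p nonneg by (simp add: ennreal_mult' mult.commute)
  qed
  also have "\<dots> = ennreal (\<Sum>A\<in>Pow J. p ^ card A * (1 - p) ^ card (J - A) * f A)"
    using p nonneg by (intro sum_ennreal) auto
  finally show "(\<integral>\<^sup>+\<omega>. ennreal (f {i \<in> J. \<omega> i}) \<partial>?M) = ennreal (bexp J (\<lambda>_. p) f)"
    by (simp add: bexp_def)
qed

lemma finite_subset_incseq:
  assumes "finite L" "incseq \<Lambda>" "L \<subseteq> (\<Union>n. \<Lambda> n)"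
  shows "\<exists>n. L \<subseteq> \<Lambda> n"
  using assms(1,3)
proof (induction L rule: finite_induct)
  case (insert y L)
  then obtain m n where "L \<subseteq> \<Lambda> m" "y \<in> \<Lambda> n" by auto
  moreover have "\<Lambda> m \<subseteq> \<Lambda> (max m n)" "\<Lambda> n \<subseteq> \<Lambda> (max m n)"
    using assms(2) by (auto simp: incseq_def)
  ultimately show ?case by blast
qed auto

lemma cluster_exhaustion:
  assumes "incseq \<Lambda>" "A \<subseteq> (\<Union>n. \<Lambda> n)"
  shows "incseq (\<lambda>n. cluster N (A \<inter> \<Lambda> n) x)" "(\<Union>n. cluster N (A \<inter> \<Lambda> n) x) = cluster N A x"
proof -
  show "incseq (\<lambda>n. cluster N (A \<inter> \<Lambda> n) x)"
    using assms(1) by (auto simp: incseq_def intro!: cluster_mono)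
  have "y \<in> (\<Union>n. cluster N (A \<inter> \<Lambda> n) x)" if "y \<in> cluster N A x" for y
  proof -
    obtain L where L: "finite L" "L \<subseteq> A" "y \<in> cluster N L x"
      using cluster_finitary[OF \<open>y \<in> cluster N A x\<close>] by blast
    have "L \<subseteq> (\<Union>n. \<Lambda> n)" using L(2) assms(2) by blast
    then obtain n where "L \<subseteq> \<Lambda> n"
      using finite_subset_incseq[OF L(1) assms(1)] by blast
    then have "cluster N L x \<subseteq> cluster N (A \<inter> \<Lambda> n) x" using L(2) by (intro cluster_mono) auto
    then show ?thesis using L(3) by blast
  qed
  moreover have "cluster N (A \<inter> \<Lambda> n) x \<subseteq> cluster N A x" for n by (rule cluster_mono) auto
  ultimately show "(\<Union>n. cluster N (A \<inter> \<Lambda> n) x) = cluster N A x" by blast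
qed

context percolation_graph
begin

text \<open>Monotone convergence along an exhaustion of the graph by finite windows. The bijection \<open>h\<close> from
  the labels \<open>I0\<close> of the configuration to the random sites \<open>I\<close> is the identity for site percolation
  and \<open>Inr\<close> for bond percolation.\<close>

lemma
  fixes h :: "'i \<Rightarrow> 'w" and x :: 'w
  assumes "countable W" and h: "inj_on h I0" "h ` I0 = I" and p: "p \<in> {0..1}"
  defines "F \<equiv> \<lambda>\<omega>. emeasure (count_space UNIV) (cluster N ((W - I) \<union> h ` {i \<in> I0. \<omega> i}) x)"
  shows borel_measurable_cluster_size: "F \<in> borel_measurable (bernoulli_product I0 p)"
    and nn_integral_cluster_size: "(\<integral>\<^sup>+\<omega>. F \<omega> \<partial>bernoulli_product I0 p) = susceptibility p x"
proof -
  let ?M = "bernoulli_product I0 p"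
  define \<Lambda> where "\<Lambda> n = from_nat_into W ` {..<n}" for n
  have "W \<noteq> {}" using infinite_graph by auto
  have \<Lambda>: "incseq \<Lambda>" "\<And>n. finite (\<Lambda> n)" "\<And>n. \<Lambda> n \<subseteq> W"
    using from_nat_into[OF \<open>W \<noteq> {}\<close>] by (auto simp: \<Lambda>_def incseq_def)
  have cover: "W \<subseteq> (\<Union>n. \<Lambda> n)"
  proof
    fix w assume "w \<in> W"
    then have "w = from_nat_into W (to_nat_on W w)" using assms(1) by simp
    then show "w \<in> (\<Union>n. \<Lambda> n)" unfolding \<Lambda>_def by blast
  qed
  define J where "J n = {i \<in> I0. h i \<in> \<Lambda> n}" for n
  define g where "g n B = real (card (cluster N ((\<Lambda> n - I) \<union> B) x))" for n B
  have hJ: "h ` J n = \<Lambda> n \<inter> I" for n using h(2) by (auto simp: J_def)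
  have injJ: "inj_on h (J n)" for n using h(1) by (rule inj_on_subset) (auto simp: J_def)
  have J: "finite (J n)" "J n \<subseteq> I0" for n
    using finite_imageD[OF _ injJ[of n]] \<Lambda>(2)[of n] hJ[of n] by (auto simp: J_def)
  define O' where "O' \<omega> = (W - I) \<union> h ` {i \<in> I0. \<omega> i}" for \<omega>
  have O_W: "O' \<omega> \<subseteq> (\<Union>n. \<Lambda> n)" for \<omega> using cover h(2) random_sites by (auto simp: O'_def)
  have O_\<Lambda>: "O' \<omega> \<inter> \<Lambda> n = (\<Lambda> n - I) \<union> h ` {i \<in> J n. \<omega> i}" for \<omega> n
    using \<Lambda>(3)[of n] by (auto simp: O'_def J_def)
  have size: "emeasure (count_space UNIV) (cluster N (O' \<omega> \<inter> \<Lambda> n) x) = ennreal (g n (h ` {i \<in> J n. \<omega> i}))"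
    for \<omega> n
    unfolding g_def O_\<Lambda>[symmetric]
    using cluster_subset[of N "O' \<omega> \<inter> \<Lambda> n" x, THEN finite_subset] \<Lambda>(2)[of n]
    by (subst emeasure_count_space_finite) (auto simp: ennreal_of_nat_eq_real_of_nat)
  have F: "F \<omega> = (SUP n. ennreal (g n (h ` {i \<in> J n. \<omega> i})))" for \<omega>
    unfolding size[symmetric] F_def O'_def[symmetric] cluster_exhaustion(2)[OF \<Lambda>(1) O_W[of \<omega>], of N x, symmetric]
    by (intro SUP_emeasure_incseq[symmetric] cluster_exhaustion(1)[OF \<Lambda>(1) O_W]) auto
  have meas: "(\<lambda>\<omega>. ennreal (g n (h ` {i \<in> J n. \<omega> i}))) \<in> borel_measurable ?M" for n
    using borel_measurable_local[OF J p, of "\<lambda>A. g n (h ` A)" n] by (simp add: g_def)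
  show "F \<in> borel_measurable ?M"
    unfolding F by (intro borel_measurable_SUP meas) auto
  have int: "(\<integral>\<^sup>+\<omega>. ennreal (g n (h ` {i \<in> J n. \<omega> i})) \<partial>?M) = ennreal (mean_size N (\<Lambda> n) (weight p) x)" for n
  proof -
    have "(\<integral>\<^sup>+\<omega>. ennreal (g n (h ` {i \<in> J n. \<omega> i})) \<partial>?M) = ennreal (bexp (J n) (\<lambda>_. p) (\<lambda>A. g n (h ` A)))"
      by (rule nn_integral_local[OF J p]) (simp add: g_def)
    also have "bexp (J n) (\<lambda>_. p) (\<lambda>A. g n (h ` A)) = bexp (J n) (\<lambda>i. weight p (h i)) (\<lambda>A. g n (h ` A))"
      unfolding bexp_def
      by (intro sum.cong arg_cong2[where f="(*)"] prod.cong) (use hJ[of n] in \<open>auto simp: weight_def\<close>)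
    also have "\<dots> = bexp (\<Lambda> n \<inter> I) (weight p) (g n)"
      using bexp_reindex[OF injJ[of n] J(1)[of n], of "weight p" "g n"] hJ by simp
    also have "\<dots> = bexp (\<Lambda> n \<inter> I) (weight p) (\<lambda>A. real (card (cluster N (A \<union> (\<Lambda> n - I)) x)))"
      by (simp add: g_def[abs_def] Un_commute)
    also have "\<dots> = bexp ((\<Lambda> n \<inter> I) \<union> (\<Lambda> n - I)) (weight p) (\<lambda>A. real (card (cluster N A x)))"
      by (rule bexp_certain[symmetric]) (use \<Lambda>(2) in \<open>auto simp: weight_def\<close>)
    also have "(\<Lambda> n \<inter> I) \<union> (\<Lambda> n - I) = \<Lambda> n" by blast
    finally show ?thesis by (simp add: mean_size_def)
  qed
  have "(\<integral>\<^sup>+\<omega>. F \<omega> \<partial>?M) = (SUP n. \<integral>\<^sup>+\<omega>. ennreal (g n (h ` {i \<in> J n. \<omega> i})) \<partial>?M)"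
    unfolding F
  proof (rule nn_integral_monotone_convergence_SUP[OF _ meas])
    show "incseq (\<lambda>n \<omega>. ennreal (g n (h ` {i \<in> J n. \<omega> i})))"
      unfolding size[symmetric]
      by (rule incseq_SucI) (intro le_funI emeasure_mono incseq_SucD[OF cluster_exhaustion(1)[OF \<Lambda>(1) O_W]]; simp)
  qed
  also have "\<dots> = (SUP n. ennreal (mean_size N (\<Lambda> n) (weight p) x))" unfolding int ..
  also have "\<dots> = susceptibility p x"
  proof (rule antisym)
    show "(SUP n. ennreal (mean_size N (\<Lambda> n) (weight p) x)) \<le> susceptibility p x"
      by (intro SUP_least mean_size_le_susceptibility \<Lambda>)
    show "susceptibility p x \<le> (SUP n. ennreal (mean_size N (\<Lambda> n) (weight p) x))"
      unfolding susceptibility_def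
    proof (rule SUP_least)
      fix L assume "L \<in> {L. finite L \<and> L \<subseteq> W}"
      then obtain n where "L \<subseteq> \<Lambda> n" using finite_subset_incseq[OF _ \<Lambda>(1)] cover by blast
      then have "mean_size N L (weight p) x \<le> mean_size N (\<Lambda> n) (weight p) x"
        using \<Lambda>(2) weight_bounds[OF p] by (intro mean_size_mono) auto
      then show "ennreal (mean_size N L (weight p) x) \<le> (SUP n. ennreal (mean_size N (\<Lambda> n) (weight p) x))"
        by (intro SUP_upper2[of n] ennreal_leI) auto
    qed
  qed
  finally show "(\<integral>\<^sup>+\<omega>. F \<omega> \<partial>?M) = susceptibility p x" .
qed

end

section \<open>Site percolation\<close>

lemma aut_orbit_representatives:
  assumes "quasi_transitive_graph V E"
  obtains R where "finite R" "R \<subseteq> V" "\<And>x. x \<in> V \<Longrightarrow> \<exists>r\<in>R. \<exists>f\<in>graph_auts V E. f r = x"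
proof
  let ?rep = "\<lambda>O'. SOME r. r \<in> V \<and> aut_orbit V E r = O'"
  define R where "R = ?rep ` aut_orbit V E ` V"
  show "finite R" using assms by (simp add: R_def quasi_transitive_graph_def)
  have rep: "?rep (aut_orbit V E x) \<in> V \<and> aut_orbit V E (?rep (aut_orbit V E x)) = aut_orbit V E x"
    if "x \<in> V" for x
    by (rule someI[where x=x]) (use that in simp)
  show "R \<subseteq> V" unfolding R_def using rep by blast
  fix x assume x: "x \<in> V"
  let ?r = "?rep (aut_orbit V E x)"
  have "id \<in> graph_auts V E" by (simp add: graph_auts_def)
  then have "id x \<in> aut_orbit V E x" unfolding aut_orbit_def by (rule imageI)
  then have "x \<in> aut_orbit V E ?r" using rep[OF x] by simp
  then obtain f where "f \<in> graph_auts V E" "f ?r = x" unfolding aut_orbit_def by (auto simp only: image_iff)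
  moreover have "?r \<in> R" unfolding R_def by (intro imageI x)
  ultimately show "\<exists>r\<in>R. \<exists>f\<in>graph_auts V E. f r = x"
    by (intro bexI[of _ ?r] bexI[of _ f])
qed

lemma simple_graph_edge:
  assumes "simple_graph V E" "e \<in> E"
  obtains u v where "e = {u, v}" "u \<noteq> v" "u \<in> V" "v \<in> V"
  using assms by (auto simp: simple_graph_def card_2_iff)

lemma simple_graph_finite_edge: "simple_graph V E \<Longrightarrow> e \<in> E \<Longrightarrow> finite e"
  by (auto simp: simple_graph_def intro: card_ge_0_finite)

lemma finite_neighbours:
  assumes "simple_graph V E" "locally_finite_graph V E"
  shows "finite (adj_rel E `` {u})"
proof (cases "u \<in> V")
  case True
  have "adj_rel E `` {u} \<subseteq> \<Union>{e \<in> E. u \<in> e}" by (auto simp: adj_rel_def)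
  moreover have "finite (\<Union>{e \<in> E. u \<in> e})"
    using assms(2) True simple_graph_finite_edge[OF assms(1)]
    by (intro finite_Union) (auto simp: locally_finite_graph_def)
  ultimately show ?thesis by (rule finite_subset)
next
  case False
  then have "adj_rel E `` {u} = {}" using assms(1) by (auto simp: adj_rel_def simple_graph_def)
  then show ?thesis by simp
qed

lemma site_cluster_eq:
  assumes "simple_graph V E"
  shows "site_cluster V E \<omega> x = cluster (adj_rel E) {v \<in> V. \<omega> v} x"
proof -
  have "adj_rel {e \<in> E. \<forall>v\<in>e. \<omega> v} = adj_rel E \<inter> {v \<in> V. \<omega> v} \<times> {v \<in> V. \<omega> v}"
    using assms by (auto simp: adj_rel_def simple_graph_def)
  then show ?thesis
    using cluster_subset[of "adj_rel E" "{v \<in> V. \<omega> v}" x]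
    by (auto simp: site_cluster_def graph_component_def cluster_def)
qed

lemma site_percolation_graph:
  assumes "simple_graph V E" "infinite V" "connected_graph V E" "locally_finite_graph V E"
    "quasi_transitive_graph V E"
  shows "percolation_graph V (adj_rel E) V"
proof
  show "adj_rel E \<subseteq> V \<times> V" using assms(1) by (auto simp: adj_rel_def simple_graph_def)
  show "infinite V" by fact
  show "finite (adj_rel E `` {u})" for u by (rule finite_neighbours[OF assms(1,4)])
  show "(x, y) \<in> (adj_rel E)\<^sup>*" if "x \<in> V" "y \<in> V" for x y
    using assms(3) that by (simp add: connected_graph_def)
  show "V \<subseteq> V" ..
  obtain R where R: "finite R" "R \<subseteq> V" "\<And>x. x \<in> V \<Longrightarrow> \<exists>r\<in>R. \<exists>f\<in>graph_auts V E. f r = x"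
    using aut_orbit_representatives[OF assms(5)] by blast
  show "\<exists>R. finite R \<and> R \<subseteq> V \<and> (\<forall>x\<in>V. \<exists>r\<in>R. \<exists>h. bij_betw h V V \<and> h r = x \<and>
      (\<forall>u\<in>V. \<forall>v\<in>V. (h u, h v) \<in> adj_rel E \<longleftrightarrow> (u, v) \<in> adj_rel E) \<and> (\<forall>u\<in>V. h u \<in> V \<longleftrightarrow> u \<in> V))"
  proof (intro exI[of _ R] conjI ballI R(1,2))
    fix x assume "x \<in> V"
    then obtain r f where "r \<in> R" "f \<in> graph_auts V E" "f r = x" using R(3) by blast
    then show "\<exists>r\<in>R. \<exists>h. bij_betw h V V \<and> h r = x \<and>
      (\<forall>u\<in>V. \<forall>v\<in>V. (h u, h v) \<in> adj_rel E \<longleftrightarrow> (u, v) \<in> adj_rel E) \<and> (\<forall>u\<in>V. h u \<in> V \<longleftrightarrow> u \<in> V)"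
      by (intro bexI[of _ r] exI[of _ f]) (auto simp: graph_auts_def adj_rel_def bij_betw_def)
  qed
  show "finite (cluster (adj_rel E) (V - V) x)" for x by (simp add: cluster_outside)
qed

lemma site_mean_size_eq_susceptibility:
  assumes "simple_graph V E" "countable V" "percolation_graph V (adj_rel E) V" "p \<in> {0..1}"
  shows "site_mean_size V E p x = percolation_graph.susceptibility V (adj_rel E) V p x"
  using percolation_graph.nn_integral_cluster_size[OF assms(3,2) inj_on_id[of V] _ assms(4), of x]
  by (simp add: site_mean_size_def site_cluster_eq[OF assms(1)])

section \<open>Bond percolation as site percolation on the incidence graph\<close>

text \<open>The incidence graph, in which a vertex is adjacent to the edges that contain it. A bond cluster
  consists of the vertices in a site cluster of this graph.\<close>

definition incidence :: "'a set set \<Rightarrow> (('a + 'a set) \<times> ('a + 'a set)) set" where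
  "incidence E = {(Inl v, Inr e) |v e. e \<in> E \<and> v \<in> e} \<union> {(Inr e, Inl v) |v e. e \<in> E \<and> v \<in> e}"

lemma incidence_iff [simp]:
  "(Inl v, Inr e) \<in> incidence E \<longleftrightarrow> e \<in> E \<and> v \<in> e"
  "(Inr e, Inl v) \<in> incidence E \<longleftrightarrow> e \<in> E \<and> v \<in> e"
  "(Inl v, Inl w) \<notin> incidence E" "(Inr e, Inr e') \<notin> incidence E"
  by (auto simp: incidence_def)

lemma bond_cluster_eq:
  assumes "simple_graph V E" "x \<in> V"
  shows "bond_cluster V E \<omega> x = {y. Inl y \<in> cluster (incidence E) (Inl ` V \<union> Inr ` {e \<in> E. \<omega> e}) (Inl x)}"
    (is "_ = {y. Inl y \<in> cluster ?N ?A _}")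
proof (intro subset_antisym subsetI CollectI)
  fix y assume "y \<in> bond_cluster V E \<omega> x"
  then have "(x, y) \<in> (adj_rel {e \<in> E. \<omega> e})\<^sup>*" by (simp add: bond_cluster_def graph_component_def)
  then show "Inl y \<in> cluster ?N ?A (Inl x)"
  proof (induction rule: rtrancl_induct)
    case base
    show ?case by (rule cluster_self) (use assms(2) in auto)
  next
    case (step y z)
    then have e: "{y, z} \<in> E" "\<omega> {y, z}" by (auto simp: adj_rel_def)
    then have yz: "y \<in> V" "z \<in> V" using assms(1) by (auto simp: simple_graph_def)
    have "Inr {y, z} \<in> cluster ?N ?A (Inl x)"
      by (rule cluster_step[OF step.IH]) (use e yz in auto)
    then show ?case by (rule cluster_step) (use e yz in auto)
  qed
next
  have in_V: "v \<in> V" if "e \<in> E" "v \<in> e" for e v using assms(1) that by (auto simp: simple_graph_def)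
  fix y assume "y \<in> {y. Inl y \<in> cluster ?N ?A (Inl x)}"
  then have "Inl y \<in> cluster ?N ?A (Inl x)" by simp
  then have "case Inl y of Inl v \<Rightarrow> v \<in> bond_cluster V E \<omega> x | Inr e \<Rightarrow> e \<subseteq> bond_cluster V E \<omega> x"
  proof (induction rule: cluster_induct)
    case self
    then show ?case using assms(2) by (auto simp: bond_cluster_def graph_component_def)
  next
    case (step s t)
    show ?case
    proof (cases s)
      case (Inl v)
      then obtain e where t: "t = Inr e" using step(4) by (cases t) auto
      then have e: "e \<in> E" "v \<in> e" "\<omega> e" using step(3,4) Inl by auto
      have v: "v \<in> bond_cluster V E \<omega> x" using step(5) Inl by simp
      have "w \<in> bond_cluster V E \<omega> x" if "w \<in> e" for w
      proof (cases "w = v")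
        case False
        then have "e = {v, w}" using simple_graph_edge[OF assms(1) e(1)] e(2) that by (metis insertE singletonD insert_commute)
        then have "(v, w) \<in> adj_rel {e \<in> E. \<omega> e}" using e by (simp add: adj_rel_def)
        then show ?thesis
          using v in_V[OF e(1) that] assms(2)
          by (auto simp: bond_cluster_def graph_component_def intro: rtrancl_into_rtrancl)
      qed (use v in simp)
      then show ?thesis using t by auto
    next
      case (Inr e)
      then obtain w where "t = Inl w" using step(4) by (cases t) auto
      then show ?thesis using step(4,5) Inr by auto
    qed
  qed
  then show "y \<in> bond_cluster V E \<omega> x" by simp
qed

lemma incidence_path:
  assumes "(x, y) \<in> (adj_rel E)\<^sup>*"
  shows "(Inl x, Inl y) \<in> (incidence E)\<^sup>*"
  using assms
proof (induction rule: rtrancl_induct)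
  case (step y z)
  then have "(Inl y, Inr {y, z}) \<in> incidence E" "(Inr {y, z}, Inl z) \<in> incidence E"
    by (auto simp: adj_rel_def)
  with step.IH show ?case by (meson rtrancl.rtrancl_into_rtrancl)
qed simp

lemma sym_incidence: "sym (incidence E)"
  by (auto simp: sym_def incidence_def)

lemma automorphism_edge_image:
  assumes "simple_graph V E" "f \<in> graph_auts V E"
  shows "bij_betw ((`) f) E E"
proof -
  have inj: "inj_on f V" and im: "f ` V = V"
    and adj: "\<And>u v. u \<in> V \<Longrightarrow> v \<in> V \<Longrightarrow> {f u, f v} \<in> E \<longleftrightarrow> {u, v} \<in> E"
    using assms(2) by (auto simp: graph_auts_def bij_betw_def)
  have sub: "e \<subseteq> V" if "e \<in> E" for e using assms(1) that by (auto simp: simple_graph_def)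
  have "inj_on ((`) f) E"
    using inj_on_image_eq_iff[OF inj sub sub] by (auto simp: inj_on_def)
  moreover have "(`) f ` E = E"
  proof (intro subset_antisym subsetI)
    fix e assume "e \<in> (`) f ` E"
    then obtain e' where "e' \<in> E" "e = f ` e'" by blast
    moreover from simple_graph_edge[OF assms(1) \<open>e' \<in> E\<close>] obtain u v
      where "e' = {u, v}" "u \<in> V" "v \<in> V" by metis
    ultimately show "e \<in> E" using adj by simp
  next
    fix e assume e: "e \<in> E"
    obtain u v where uv: "e = {u, v}" "u \<in> V" "v \<in> V" using simple_graph_edge[OF assms(1) e] by metis
    then obtain u' v' where "u' \<in> V" "v' \<in> V" "u = f u'" "v = f v'" using im by (metis imageE)
    with uv e adj[of u' v'] have "{u', v'} \<in> E" "e = f ` {u', v'}" by auto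
    then show "e \<in> (`) f ` E" by blast
  qed
  ultimately show ?thesis by (simp add: bij_betw_def)
qed

text \<open>An automorphism of the graph acts on edges by images. Every edge is the image of an edge that
  contains an orbit representative, and by local finiteness there are finitely many of these.\<close>

lemma bond_percolation_graph:
  assumes "simple_graph V E" "infinite V" "connected_graph V E" "locally_finite_graph V E"
    "quasi_transitive_graph V E"
  shows "percolation_graph (Inl ` V \<union> Inr ` E) (incidence E) (Inr ` E)"
proof
  let ?W = "Inl ` V \<union> Inr ` E :: ('a + 'a set) set"
  have sub: "e \<subseteq> V" if "e \<in> E" for e using assms(1) that by (auto simp: simple_graph_def)
  show "incidence E \<subseteq> ?W \<times> ?W" using sub by (auto simp: incidence_def)
  show "infinite ?W" using assms(2) by (auto dest: finite_imageD)
  show "finite (incidence E `` {u})" for u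
  proof (cases u)
    case (Inl v)
    have "incidence E `` {u} \<subseteq> Inr ` {e \<in> E. v \<in> e}" using Inl by (auto simp: incidence_def)
    moreover have "finite {e \<in> E. v \<in> e}"
    proof (cases "v \<in> V")
      case True
      then show ?thesis using assms(4) by (simp add: locally_finite_graph_def)
    next
      case False
      then have "{e \<in> E. v \<in> e} = {}" using sub by auto
      then show ?thesis by (simp only: finite.emptyI)
    qed
    ultimately show ?thesis using finite_subset by blast
  next
    case (Inr e)
    have "incidence E `` {u} \<subseteq> (if e \<in> E then Inl ` e else {})" using Inr by (auto simp: incidence_def)
    moreover have "finite (if e \<in> E then Inl ` e else {} :: ('a + 'a set) set)"
      using simple_graph_finite_edge[OF assms(1)] by auto
    ultimately show ?thesis by (rule finite_subset)
  qed
  show "(s, t) \<in> (incidence E)\<^sup>*" if "s \<in> ?W" "t \<in> ?W" for s t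
  proof -
    have to_vertex: "\<exists>v\<in>V. (w, Inl v) \<in> (incidence E)\<^sup>*" if "w \<in> ?W" for w
    proof (cases w)
      case (Inl v)
      then show ?thesis using that by (intro bexI[of _ v]) auto
    next
      case (Inr e)
      then have "e \<in> E" using that by auto
      then obtain u where "u \<in> e" "u \<in> V" using simple_graph_edge[OF assms(1)] by (metis insertI1)
      then show ?thesis using Inr \<open>e \<in> E\<close> by (intro bexI[of _ u] r_into_rtrancl) auto
    qed
    from to_vertex[OF that(1)] obtain u where u: "u \<in> V" "(s, Inl u) \<in> (incidence E)\<^sup>*" ..
    from to_vertex[OF that(2)] obtain v where v: "v \<in> V" "(t, Inl v) \<in> (incidence E)\<^sup>*" ..
    have "(Inl u, Inl v) \<in> (incidence E)\<^sup>*"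
      using assms(3) u(1) v(1) by (intro incidence_path) (simp add: connected_graph_def)
    moreover have "(Inl v, t) \<in> (incidence E)\<^sup>*"
      using sym_rtrancl[OF sym_incidence] v(2) by (rule symD)
    ultimately show ?thesis using u(2) by (meson rtrancl_trans)
  qed
  show "Inr ` E \<subseteq> ?W" by blast
  obtain R where R: "finite R" "R \<subseteq> V" "\<And>x. x \<in> V \<Longrightarrow> \<exists>r\<in>R. \<exists>f\<in>graph_auts V E. f r = x"
    using aut_orbit_representatives[OF assms(5)] by blast
  define R' where "R' = Inl ` R \<union> Inr ` (\<Union>r\<in>R. {e \<in> E. r \<in> e})"
  have lift: "\<exists>h. bij_betw h ?W ?W \<and> (\<forall>v. h (Inl v) = Inl (f v)) \<and> (\<forall>e. h (Inr e) = Inr (f ` e)) \<and>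
      (\<forall>u\<in>?W. \<forall>v\<in>?W. (h u, h v) \<in> incidence E \<longleftrightarrow> (u, v) \<in> incidence E) \<and>
      (\<forall>u\<in>?W. h u \<in> Inr ` E \<longleftrightarrow> u \<in> Inr ` E)" if f: "f \<in> graph_auts V E" for f
  proof (intro exI[of _ "map_sum f ((`) f)"] conjI allI)
    let ?h = "map_sum f ((`) f)"
    have bV: "bij_betw f V V" using f by (simp add: graph_auts_def)
    have bE: "bij_betw ((`) f) E E" by (rule automorphism_edge_image[OF assms(1) f])
    show "bij_betw ?h ?W ?W"
    proof (rule bij_betw_imageI)
      show "inj_on ?h ?W"
      proof (rule inj_onI)
        fix s t assume "s \<in> ?W" "t \<in> ?W" "?h s = ?h t"
        then show "s = t"
          by (cases s; cases t)
            (auto dest: inj_onD[OF bij_betw_imp_inj_on[OF bV]] inj_onD[OF bij_betw_imp_inj_on[OF bE]])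
      qed
      have "?h ` ?W = Inl ` f ` V \<union> Inr ` (`) f ` E"
        by (auto simp: image_Un image_image)
      then show "?h ` ?W = ?W" using bV bE by (simp add: bij_betw_def)
    qed
    have fE: "f ` e \<in> E" if "e \<in> E" for e using bE that by (auto simp: bij_betw_def)
    have inc: "f v \<in> f ` e \<longleftrightarrow> v \<in> e" if "v \<in> V" "e \<in> E" for v e
      using inj_on_image_mem_iff[of f V v e] bV that sub by (auto simp: bij_betw_def)
    show "\<forall>u\<in>?W. \<forall>v\<in>?W. (?h u, ?h v) \<in> incidence E \<longleftrightarrow> (u, v) \<in> incidence E"
      using fE inc by auto
    show "\<forall>u\<in>?W. ?h u \<in> Inr ` E \<longleftrightarrow> u \<in> Inr ` E" using fE by auto
  qed auto
  show "\<exists>R. finite R \<and> R \<subseteq> ?W \<and> (\<forall>x\<in>?W. \<exists>r\<in>R. \<exists>h. bij_betw h ?W ?W \<and> h r = x \<and>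
      (\<forall>u\<in>?W. \<forall>v\<in>?W. (h u, h v) \<in> incidence E \<longleftrightarrow> (u, v) \<in> incidence E) \<and>
      (\<forall>u\<in>?W. h u \<in> Inr ` E \<longleftrightarrow> u \<in> Inr ` E))"
  proof (intro exI[of _ R'] conjI ballI)
    show "finite R'"
      unfolding R'_def using R(1,2) assms(4) by (auto simp: locally_finite_graph_def subset_eq)
    show "R' \<subseteq> ?W" using R(2) by (auto simp: R'_def)
    fix x assume x: "x \<in> ?W"
    have "\<exists>r\<in>R'. \<exists>f\<in>graph_auts V E. map_sum f ((`) f) r = x"
    proof (cases x)
      case (Inl v)
      then obtain r f where "r \<in> R" "f \<in> graph_auts V E" "f r = v" using R(3)[of v] x by auto
      then show ?thesis using Inl by (intro bexI[of _ "Inl r"] bexI[of _ f]) (auto simp: R'_def)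
    next
      case (Inr e)
      then have e: "e \<in> E" using x by auto
      then obtain v where v: "v \<in> e" "v \<in> V" using simple_graph_edge[OF assms(1)] by (metis insertI1)
      then obtain r f where r: "r \<in> R" and f: "f \<in> graph_auts V E" "f r = v" using R(3) by blast
      obtain e' where e': "e' \<in> E" "e = f ` e'"
        using bij_betw_imp_surj_on[OF automorphism_edge_image[OF assms(1) f(1)]] e by blast
      have "inj_on f V" using f(1) by (simp add: graph_auts_def bij_betw_def)
      then have "r \<in> e'"
        using inj_on_image_mem_iff[of f V r e'] sub[OF e'(1)] R(2) r v(1) f(2) e'(2) by auto
      then have "Inr e' \<in> R'" using r e'(1) by (auto simp: R'_def)
      then show ?thesis using Inr f(1) e'(2) by (intro bexI[of _ "Inr e'"] bexI[of _ f]) auto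
    qed
    then obtain r f where r: "r \<in> R'" and f: "f \<in> graph_auts V E" "map_sum f ((`) f) r = x" by blast
    obtain h where h: "bij_betw h ?W ?W" "\<forall>v. h (Inl v) = Inl (f v)" "\<forall>e. h (Inr e) = Inr (f ` e)"
      "\<forall>u\<in>?W. \<forall>v\<in>?W. (h u, h v) \<in> incidence E \<longleftrightarrow> (u, v) \<in> incidence E"
      "\<forall>u\<in>?W. h u \<in> Inr ` E \<longleftrightarrow> u \<in> Inr ` E"
      using lift[OF f(1)] by (elim exE conjE) (rule that)
    have "h r = x" using f(2) h(2,3) by (cases r) auto
    with r h(1,4,5) show "\<exists>r\<in>R'. \<exists>h. bij_betw h ?W ?W \<and> h r = x \<and>
      (\<forall>u\<in>?W. \<forall>v\<in>?W. (h u, h v) \<in> incidence E \<longleftrightarrow> (u, v) \<in> incidence E) \<and>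
      (\<forall>u\<in>?W. h u \<in> Inr ` E \<longleftrightarrow> u \<in> Inr ` E)"
      by (intro bexI[of _ r] exI[of _ h] conjI)
  qed
  show "finite (cluster (incidence E) (?W - Inr ` E) x)" for x
  proof -
    have "cluster (incidence E) (?W - Inr ` E) x \<subseteq> {x}"
    proof
      fix y assume "y \<in> cluster (incidence E) (?W - Inr ` E) x"
      then show "y \<in> {x}"
        by (induction rule: cluster_induct) (auto simp: incidence_def)
    qed
    then show ?thesis using finite_subset by blast
  qed
qed

text \<open>In the incidence graph every edge in the cluster of a vertex contains a vertex of the cluster, and
  each vertex accounts for at most \<open>d\<close> edges.\<close>

lemma incidence_cluster_size:
  assumes simple: "simple_graph V E" and x: "x \<in> V"
    and deg: "\<And>v. card (incidence E `` {Inl v}) \<le> d" and locfin: "\<And>v. finite (incidence E `` {Inl v})"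
  defines "C \<equiv> \<lambda>\<omega>. cluster (incidence E) (Inl ` V \<union> Inr ` {e \<in> E. \<omega> e}) (Inl x)"
  shows "emeasure (count_space UNIV) (bond_cluster V E \<omega> x) \<le> emeasure (count_space UNIV) (C \<omega>)"
    and "emeasure (count_space UNIV) (C \<omega>) \<le> ennreal (1 + real d) * emeasure (count_space UNIV) (bond_cluster V E \<omega> x)"
proof -
  let ?B = "bond_cluster V E \<omega> x"
  have B: "?B = {y. Inl y \<in> C \<omega>}" unfolding C_def by (rule bond_cluster_eq[OF simple x])
  have inl: "Inl ` ?B \<subseteq> C \<omega>" using B by auto
  have cover: "C \<omega> \<subseteq> Inl ` ?B \<union> (\<Union>v\<in>?B. incidence E `` {Inl v})"
  proof
    fix s assume "s \<in> C \<omega>"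
    then show "s \<in> Inl ` ?B \<union> (\<Union>v\<in>?B. incidence E `` {Inl v})"
      unfolding B unfolding C_def
    proof (induction rule: cluster_induct)
      case self
      then show ?case by (auto intro: cluster_self)
    next
      case (step s t)
      have t: "t \<in> cluster (incidence E) (Inl ` V \<union> Inr ` {e \<in> E. \<omega> e}) (Inl x)"
        using cluster_step[OF step(1,4,2,3)] .
      show ?case
      proof (cases t)
        case (Inr e)
        then obtain v where "s = Inl v" using step(4) by (cases s) auto
        then show ?thesis using step(1,4) by blast
      qed (use t in auto)
    qed
  qed
  show "emeasure (count_space UNIV) ?B \<le> emeasure (count_space UNIV) (C \<omega>)"
  proof (cases "finite (C \<omega>)")
    case True
    then have "finite (Inl ` ?B :: ('a + 'a set) set)" using inl finite_subset by blast
    then have "finite ?B" by (rule finite_imageD) simp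
    moreover have "card ?B \<le> card (C \<omega>)" using card_mono[OF True inl] by (simp add: card_image)
    ultimately show ?thesis using True by simp
  qed simp
  show "emeasure (count_space UNIV) (C \<omega>) \<le> ennreal (1 + real d) * emeasure (count_space UNIV) ?B"
  proof (cases "finite ?B")
    case True
    have fin: "finite (Inl ` ?B \<union> (\<Union>v\<in>?B. incidence E `` {Inl v}))" using True locfin by auto
    then have "finite (C \<omega>)" using cover finite_subset by blast
    have "card (C \<omega>) \<le> card (Inl ` ?B \<union> (\<Union>v\<in>?B. incidence E `` {Inl v}))"
      by (rule card_mono[OF fin cover])
    also have "\<dots> \<le> card (Inl ` ?B :: ('a + 'a set) set) + card (\<Union>v\<in>?B. incidence E `` {Inl v})"
      by (rule card_Un_le)
    also have "\<dots> \<le> card ?B + (\<Sum>v\<in>?B. card (incidence E `` {Inl v}))"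
      by (intro add_mono card_UN_le[OF True]) (simp add: card_image)
    also have "\<dots> \<le> card ?B + (\<Sum>v\<in>?B. d)" by (intro add_left_mono sum_mono deg)
    finally have "card (C \<omega>) \<le> (1 + d) * card ?B" by (simp add: mult.commute)
    then have "real (card (C \<omega>)) \<le> (1 + real d) * real (card ?B)"
      by (metis of_nat_1 of_nat_add of_nat_le_iff of_nat_mult)
    then have "ennreal (card (C \<omega>)) \<le> ennreal ((1 + real d) * real (card ?B))"
      by (rule ennreal_leI)
    also have "\<dots> = ennreal (1 + real d) * ennreal (card ?B)"
      by (rule ennreal_mult) auto
    finally show ?thesis
      using True \<open>finite (C \<omega>)\<close>
      by (simp only: emeasure_count_space_finite subset_UNIV ennreal_of_nat_eq_real_of_nat)
  next
    case False
    then show ?thesis by (simp add: ennreal_mult_top)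
  qed
qed

text \<open>Mean bond cluster sizes and incidence graph susceptibilities are finite at the same parameters
  and diverge together, so that the critical points of both models agree.\<close>

lemma bond_mean_size_comparison:
  assumes simple: "simple_graph V E" and "countable V"
    and pg: "percolation_graph (Inl ` V \<union> Inr ` E) (incidence E) (Inr ` E)"
  defines "suscept \<equiv> percolation_graph.susceptibility (Inl ` V \<union> Inr ` E) (incidence E) (Inr ` E)"
  shows "\<exists>c>0. \<forall>p\<in>{0..1}. \<forall>x\<in>V.
    bond_mean_size V E p x \<le> suscept p (Inl x) \<and> ennreal c * suscept p (Inl x) \<le> bond_mean_size V E p x"
proof -
  interpret percolation_graph "Inl ` V \<union> Inr ` E" "incidence E" "Inr ` E" by (rule pg)
  obtain d where d: "card (incidence E `` {u}) \<le> d" for u using bounded_degree by blast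
  have "E \<subseteq> {e. finite e \<and> e \<subseteq> V}"
    using simple unfolding simple_graph_def by (auto intro: card_ge_0_finite)
  then have "countable E" using countable_Collect_finite_subset[OF assms(2)] countable_subset by blast
  then have cnt: "countable (Inl ` V \<union> Inr ` E)" using assms(2) by simp
  have "bond_mean_size V E p x \<le> suscept p (Inl x) \<and> ennreal (1 / (1 + real d)) * suscept p (Inl x) \<le> bond_mean_size V E p x"
    if p: "p \<in> {0..1}" and x: "x \<in> V" for p x
  proof -
    define C where "C \<omega> = emeasure (count_space UNIV) (cluster (incidence E) (Inl ` V \<union> Inr ` {e \<in> E. \<omega> e}) (Inl x))" for \<omega>
    have diff: "Inl ` V \<union> Inr ` E - Inr ` E = (Inl ` V :: ('a + 'a set) set)" by auto
    have C: "C \<in> borel_measurable (bernoulli_product E p)" "(\<integral>\<^sup>+\<omega>. C \<omega> \<partial>bernoulli_product E p) = suscept p (Inl x)"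
      using borel_measurable_cluster_size[OF cnt _ refl p, of "Inl x"] nn_integral_cluster_size[OF cnt _ refl p, of "Inl x"]
      unfolding C_def[abs_def] suscept_def diff by simp_all
    note bounds = incidence_cluster_size[OF simple x d locfin, folded C_def]
    have "bond_mean_size V E p x \<le> suscept p (Inl x)"
      unfolding bond_mean_size_def C(2)[symmetric] by (intro nn_integral_mono bounds(1))
    moreover have "ennreal (1 / (1 + real d)) * suscept p (Inl x) \<le> bond_mean_size V E p x"
    proof -
      have "ennreal (1 / (1 + real d)) * suscept p (Inl x) = (\<integral>\<^sup>+\<omega>. ennreal (1 / (1 + real d)) * C \<omega> \<partial>bernoulli_product E p)"
        unfolding C(2)[symmetric] by (rule nn_integral_cmult[OF C(1), symmetric])
      also have "\<dots> \<le> bond_mean_size V E p x"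
        unfolding bond_mean_size_def
      proof (rule nn_integral_mono)
        fix \<omega>
        have "ennreal (1 / (1 + real d)) * C \<omega>
            \<le> ennreal (1 / (1 + real d)) * (ennreal (1 + real d) * emeasure (count_space UNIV) (bond_cluster V E \<omega> x))"
          by (intro mult_left_mono bounds(2)) auto
        also have "\<dots> = emeasure (count_space UNIV) (bond_cluster V E \<omega> x)"
        proof -
          have "ennreal (1 / (1 + real d)) * ennreal (1 + real d) = 1"
            by (subst ennreal_mult[symmetric]) auto
          then show ?thesis by (simp only: mult.assoc[symmetric] mult_1_left)
        qed
        finally show "ennreal (1 / (1 + real d)) * C \<omega> \<le> emeasure (count_space UNIV) (bond_cluster V E \<omega> x)" .
      qed
      finally show ?thesis .
    qed
    ultimately show ?thesis by blast
  qed
  then show ?thesis by (intro exI[of _ "1 / (1 + real d)"]) auto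
qed

section \<open>Divergence at the critical point\<close>

lemma eventually_at_left_unit_interval:
  assumes "0 < t" "t \<le> (1 :: real)"
  shows "eventually (\<lambda>p. p \<in> {0..1}) (at_left t)"
  using eventually_at_left_real[OF assms(1)] by eventually_elim (use assms(2) in auto)

theorem proposition5:
  fixes V :: "'a set" and E :: "'a set set"
  assumes "simple_graph V E"
    and "infinite V"
    and "countable V"
    and "connected_graph V E"
    and "locally_finite_graph V E"
    and "quasi_transitive_graph V E"
  shows "\<forall>z\<in>V. \<forall>x\<in>V.
      ((\<lambda>p. bond_mean_size V E p x) \<longlongrightarrow> \<infinity>) (at_left (bond_pT V E z)) \<and>
      bond_mean_size V E (bond_pT V E z) x = \<infinity> \<and>
      ((\<lambda>p. site_mean_size V E p x) \<longlongrightarrow> \<infinity>) (at_left (site_pT V E z)) \<and>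
      site_mean_size V E (site_pT V E z) x = \<infinity>"
proof (intro ballI conjI)
  fix z x assume z: "z \<in> V" and x: "x \<in> V"
  note pg = site_percolation_graph[OF assms(1,2,4,5,6)]
  let ?suscept = "percolation_graph.susceptibility V (adj_rel E) V"
  note site = site_mean_size_eq_susceptibility[OF assms(1,3) pg]
  have pT: "site_pT V E z = Sup {p \<in> {0..1}. ?suscept p z < \<infinity>}"
    unfolding site_pT_def using site by (intro arg_cong[where f=Sup]) auto
  note crit = percolation_graph.susceptibility_infinite_at_critical[OF pg z x, folded pT]
  show "site_mean_size V E (site_pT V E z) x = \<infinity>"
    using site crit by auto
  show "((\<lambda>p. site_mean_size V E p x) \<longlongrightarrow> \<infinity>) (at_left (site_pT V E z))"
  proof (rule Lim_transform_eventually)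
    show "((\<lambda>p. ?suscept p x) \<longlongrightarrow> \<infinity>) (at_left (site_pT V E z))" using crit by blast
    show "eventually (\<lambda>p. ?suscept p x = site_mean_size V E p x) (at_left (site_pT V E z))"
      using eventually_at_left_unit_interval[of "site_pT V E z"] crit by (auto elim!: eventually_mono simp: site)
  qed
next
  fix z x assume z: "z \<in> V" and x: "x \<in> V"
  note pg = bond_percolation_graph[OF assms(1,2,4,5,6)]
  let ?suscept = "percolation_graph.susceptibility (Inl ` V \<union> Inr ` E) (incidence E) (Inr ` E)"
  obtain c where c: "0 < c" and upper: "\<And>p x. p \<in> {0..1} \<Longrightarrow> x \<in> V \<Longrightarrow> bond_mean_size V E p x \<le> ?suscept p (Inl x)"
    and lower: "\<And>p x. p \<in> {0..1} \<Longrightarrow> x \<in> V \<Longrightarrow> ennreal c * ?suscept p (Inl x) \<le> bond_mean_size V E p x"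
    using bond_mean_size_comparison[OF assms(1,3) pg] by blast
  have finite_iff: "bond_mean_size V E p x < \<infinity> \<longleftrightarrow> ?suscept p (Inl x) < \<infinity>" if "p \<in> {0..1}" "x \<in> V" for p x
  proof
    assume "bond_mean_size V E p x < \<infinity>"
    then have "ennreal c * ?suscept p (Inl x) < \<infinity>" using lower[OF that] by (rule le_less_trans[rotated])
    then show "?suscept p (Inl x) < \<infinity>" using c by (auto simp: ennreal_mult_less_top)
  qed (use upper[OF that] in \<open>rule le_less_trans\<close>)
  have pT: "bond_pT V E z = Sup {p \<in> {0..1}. ?suscept p (Inl z) < \<infinity>}"
    unfolding bond_pT_def using finite_iff[OF _ z] by (intro arg_cong[where f=Sup]) auto
  have "Inl z \<in> Inl ` V \<union> Inr ` E" "Inl x \<in> Inl ` V \<union> Inr ` E" using z x by auto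
  note crit = percolation_graph.susceptibility_infinite_at_critical[OF pg this, folded pT]
  show "bond_mean_size V E (bond_pT V E z) x = \<infinity>"
  proof -
    have "\<not> bond_mean_size V E (bond_pT V E z) x < \<infinity>"
      using finite_iff[OF _ x, of "bond_pT V E z"] crit by auto
    then show ?thesis by (simp add: not_less top_unique)
  qed
  show "((\<lambda>p. bond_mean_size V E p x) \<longlongrightarrow> \<infinity>) (at_left (bond_pT V E z))"
  proof (rule tendsto_sandwich)
    show "eventually (\<lambda>p. ennreal c * ?suscept p (Inl x) \<le> bond_mean_size V E p x) (at_left (bond_pT V E z))"
      using eventually_at_left_unit_interval[of "bond_pT V E z"] crit by (auto elim!: eventually_mono simp: lower[OF _ x])
    show "eventually (\<lambda>p. bond_mean_size V E p x \<le> \<infinity>) (at_left (bond_pT V E z))" by simp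
    have "((\<lambda>p. ennreal c * ?suscept p (Inl x)) \<longlongrightarrow> ennreal c * \<infinity>) (at_left (bond_pT V E z))"
      using crit by (intro ennreal_tendsto_cmult) auto
    then show "((\<lambda>p. ennreal c * ?suscept p (Inl x)) \<longlongrightarrow> \<infinity>) (at_left (bond_pT V E z))"
      using c by (simp add: ennreal_mult_top)
  qed simp
qed

end
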